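(* Suppose $\mathrm{R}^{\mathrm{St}}:\mathrm{T}\,\mathrm{St}(n,r)\to\mathrm{St}(n,r)$ is a retraction on $\mathrm{St}(n,r)$ and $\mathrm{R}^{\mathcal{H}}:\mathrm{T}\mathcal{H}^r\to\mathcal{H}^r$ is a retraction on $\mathcal{H}^r$. If both $\mathrm{R}^{\mathrm{St}}$ and $\mathrm{R}^{\mathcal{H}}$ are orthogonally homogeneous, then the mapping $\mathrm{R}$ defined by $$\mathrm{R}_{(X,G)}(\eta,\zeta)=\Big(\mathrm{R}^{\mathcal{H}}_H(K)\big(\mathrm{R}^{\mathrm{St}}_V(V_p)\big)^\top,\ I-\mathrm{R}^{\mathrm{St}}_V(V_p)\big(\mathrm{R}^{\mathrm{St}}_V(V_p)\big)^\top\Big),$$ where $(H,V)$ and $(K,V_p)$ are representations of $(X,G)\in\mathcal{M}_h$ and $(\eta,\zeta)\in\mathrm{T}_{(X,G)}\mathcal{M}_h$, respectively, is a retraction on $\mathcal{M}_h$.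
   Context: Let $r\le\min\{m,n\}$ be a positive integer. The map $h:\mathbb{R}^{m\times n}\to\mathbb{R}^q$ is smooth and orthogonally invariant, i.e. $h(XQ)=h(X)$ for all $X$ and all $Q\in\mathcal{O}(n)=\{Q\in\mathbb{R}^{n\times n}:Q^\top Q=I_n\}$. Put $\mathcal{H}=\{X\in\mathbb{R}^{m\times n}:h(X)=0\}$; it is assumed that the differential $\mathrm{D}h_X$ has rank $q$ for all $X\in\mathcal{H}$. Define $\mathcal{H}^r=\{H\in\mathbb{R}^{m\times r}:h([H\ \ 0^{m\times(n-r)}])=0\}$, an embedded submanifold of $\mathbb{R}^{m\times r}$ when nonempty; it is closed under $H\mapsto HQ$, $Q\in\mathcal{O}(r)$. $\mathrm{Sym}(n)$: symmetric $n\times n$ matrices; $\mathrm{Gr}(n,n-r)=\{G\in\mathrm{Sym}(n):G^2=G,\operatorname{rank}(G)=n-r\}$; $\mathrm{St}(n,r)=\{V\in\mathbb{R}^{n\times r}:V^\top V=I_r\}$. Define $\mathcal{M}_h=\{(X,G)\in\mathbb{R}^{m\times n}\times\mathrm{Gr}(n,n-r):XG=0,\ h(X)=0\}$, an embedded submanifold of $\mathbb{R}^{m\times n}\times\mathrm{Sym}(n)$. A representation of $(X,G)\in\mathcal{M}_h$ is a pair $(H,V)\in\mathcal{H}^r\times\mathrm{St}(n,r)$ with $X=HV^\top$, $G=I-VV^\top$ (one always exists). The tangent space is $\mathrm{T}_{(X,G)}\mathcal{M}_h=\{(KV^\top+HV_p^\top,-V_pV^\top-VV_p^\top):K\in\mathrm{T}_H\mathcal{H}^r,\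 V_p\in\mathbb{R}^{n\times r},\ V^\top V_p=0\}$; $(K,V_p)$ is said to represent (with respect to $(H,V)$) the tangent vector $(\eta,\zeta)=(KV^\top+HV_p^\top,-V_pV^\top-VV_p^\top)$. A smooth mapping $\mathrm{R}:\mathrm{T}\mathcal{M}\to\mathcal{M}$ is a retraction on a manifold $\mathcal{M}$ if for any $X\in\mathcal{M}$, $\xi\in\mathrm{T}_X\mathcal{M}$, the curve $\gamma(t)=\mathrm{R}_X(t\xi)$ satisfies $\gamma(0)=X$, $\gamma'(0)=\xi$, where $\mathrm{R}_X$ is the restriction of $\mathrm{R}$ to $\mathrm{T}_X\mathcal{M}$. If $\mathcal{M}\subseteq\mathbb{R}^{a\times b}$ is a manifold with $XQ\in\mathcal{M}$ for all $X\in\mathcal{M}$, $Q\in\mathcal{O}(b)$, a mapping $\mathrm{R}:\mathrm{T}\mathcal{M}\to\mathcal{M}$ is orthogonally homogeneous if $\mathrm{R}_X(\xi)Q=\mathrm{R}_{XQ}(\xi Q)$ for any $Q\in\mathcal{O}(b)$ and $(X,\xi)\in\mathrm{T}\mathcal{M}$. *)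

theory Defs
  imports "HOL-Analysis.Analysis"
begin

text \<open>On an open set \<open>U\<close> of a Euclidean space this is the usual class of \<open>k\<close> times continuously
  differentiable maps: all directional derivatives are of the preceding class.\<close>

primrec Ck_on :: "nat \<Rightarrow> 'a::euclidean_space set \<Rightarrow> ('a \<Rightarrow> 'b::real_normed_vector) \<Rightarrow> bool" where
  "Ck_on 0 U f \<longleftrightarrow> continuous_on U f"
| "Ck_on (Suc k) U f \<longleftrightarrow>
     (\<forall>x\<in>U. f differentiable (at x)) \<and> (\<forall>v. Ck_on k U (\<lambda>x. frechet_derivative f (at x) v))"

definition smooth_on_open :: "'a::euclidean_space set \<Rightarrow> ('a \<Rightarrow> 'b::real_normed_vector) \<Rightarrow> bool" where
  "smooth_on_open U f \<longleftrightarrow> open U \<and> (\<forall>k. Ck_on k U f)"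

text \<open>Smoothness on an arbitrary subset, by local smooth extension to the ambient space. On an
  embedded submanifold this agrees with smoothness in charts.\<close>

definition smooth_map_on :: "'a::euclidean_space set \<Rightarrow> ('a \<Rightarrow> 'b::real_normed_vector) \<Rightarrow> bool" where
  "smooth_map_on S f \<longleftrightarrow>
     (\<forall>x\<in>S. \<exists>U g. x \<in> U \<and> smooth_on_open U g \<and> (\<forall>y\<in>S \<inter> U. f y = g y))"

text \<open>The tangent space of an embedded submanifold: velocities at \<open>x\<close> of smooth curves in \<open>M\<close>.\<close>

definition tangent_space :: "'a::euclidean_space set \<Rightarrow> 'a \<Rightarrow> 'a set" where
  "tangent_space M x =
     {v. \<exists>\<gamma> \<epsilon>. (\<epsilon>::real) > 0 \<and> smooth_on_open {-\<epsilon><..<\<epsilon>} \<gamma> \<and> \<gamma> ` {-\<epsilon><..<\<epsilon>} \<subseteq> M \<and>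
           \<gamma> 0 = x \<and> (\<gamma> has_vector_derivative v) (at 0)}"

definition tangent_bundle :: "'a::euclidean_space set \<Rightarrow> ('a \<times> 'a) set" where
  "tangent_bundle M = (SIGMA x:M. tangent_space M x)"

text \<open>A map on the tangent bundle is a total function on pairs, of which only the values on
  \<open>tangent_bundle M\<close> matter; \<open>R (x, \<xi>)\<close> stands for \<open>R\<^sub>x(\<xi>)\<close>.\<close>

definition is_retraction :: "'a::euclidean_space set \<Rightarrow> ('a \<times> 'a \<Rightarrow> 'a) \<Rightarrow> bool" where
  "is_retraction M R \<longleftrightarrow>
     R ` tangent_bundle M \<subseteq> M \<and> smooth_map_on (tangent_bundle M) R \<and>
     (\<forall>x\<in>M. \<forall>\<xi>\<in>tangent_space M x.
        R (x, 0 *\<^sub>R \<xi>) = x \<and> ((\<lambda>t. R (x, t *\<^sub>R \<xi>)) has_vector_derivative \<xi>) (at 0))"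

definition orthogonally_homogeneous ::
    "(real^'b^'a) set \<Rightarrow> ((real^'b^'a) \<times> (real^'b^'a) \<Rightarrow> real^'b^'a) \<Rightarrow> bool" where
  "orthogonally_homogeneous M R \<longleftrightarrow>
     (\<forall>Q. orthogonal_matrix Q \<longrightarrow>
        (\<forall>(X, \<xi>) \<in> tangent_bundle M. R (X, \<xi>) ** Q = R (X ** Q, \<xi> ** Q)))"

definition stiefel :: "(real^'r^'n) set" where
  "stiefel = {V. transpose V ** V = mat 1}"

definition grassmannian :: "nat \<Rightarrow> (real^'n^'n) set" where
  "grassmannian k = {G. transpose G = G \<and> G ** G = G \<and> rank G = k}"

definition orthogonally_invariant :: "(real^'n^'m \<Rightarrow> 'b) \<Rightarrow> bool" where
  "orthogonally_invariant h \<longleftrightarrow> (\<forall>X Q. orthogonal_matrix Q \<longrightarrow> h (X ** Q) = h X)"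

text \<open>The block matrix \<open>[H 0]\<close>. As the column indices form unordered finite types, the columns that
  \<open>H\<close> occupies are given by an injection \<open>\<iota>\<close> (for \<open>{1..r}\<close> and \<open>{1..n}\<close>, the inclusion).\<close>

definition pad_columns :: "('r \<Rightarrow> 'n) \<Rightarrow> real^'r^'m \<Rightarrow> real^'n^'m" where
  "pad_columns \<iota> H = (\<chi> i j. if j \<in> range \<iota> then H $ i $ (inv \<iota> j) else 0)"

definition Hr :: "('r \<Rightarrow> 'n) \<Rightarrow> (real^'n^'m \<Rightarrow> real^'q) \<Rightarrow> (real^'r^'m) set" where
  "Hr \<iota> h = {H. h (pad_columns \<iota> H) = 0}"

definition Mh :: "nat \<Rightarrow> (real^'n^'m \<Rightarrow> real^'q) \<Rightarrow> ((real^'n^'m) \<times> (real^'n^'n)) set" where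
  "Mh r h = {(X, G). G \<in> grassmannian (CARD('n) - r) \<and> X ** G = 0 \<and> h X = 0}"

definition represents_point ::
    "('r \<Rightarrow> 'n) \<Rightarrow> (real^'n^'m \<Rightarrow> real^'q) \<Rightarrow> real^'r^'m \<Rightarrow> real^'r^'n \<Rightarrow>
     real^'n^'m \<Rightarrow> real^'n^'n \<Rightarrow> bool" where
  "represents_point \<iota> h H V X G \<longleftrightarrow>
     H \<in> Hr \<iota> h \<and> V \<in> stiefel \<and> X = H ** transpose V \<and> G = mat 1 - V ** transpose V"

definition represents_tangent ::
    "('r \<Rightarrow> 'n) \<Rightarrow> (real^'n^'m \<Rightarrow> real^'q) \<Rightarrow> real^'r^'m \<Rightarrow> real^'r^'n \<Rightarrow>
     real^'r^'m \<Rightarrow> real^'r^'n \<Rightarrow> real^'n^'m \<Rightarrow> real^'n^'n \<Rightarrow> bool" where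
  "represents_tangent \<iota> h H V K Vp \<eta> \<zeta> \<longleftrightarrow>
     K \<in> tangent_space (Hr \<iota> h) H \<and> transpose V ** Vp = 0 \<and>
     \<eta> = K ** transpose V + H ** transpose Vp \<and>
     \<zeta> = - (Vp ** transpose V) - V ** transpose Vp"

text \<open>\<open>Y\<close> is the value at \<open>((X, G), (\<eta>, \<zeta>))\<close> given by the defining formula for some choice of
  representations.\<close>

definition lifted_value ::
    "('r \<Rightarrow> 'n) \<Rightarrow> (real^'n^'m \<Rightarrow> real^'q) \<Rightarrow>
     ((real^'r^'m) \<times> (real^'r^'m) \<Rightarrow> real^'r^'m) \<Rightarrow>
     ((real^'r^'n) \<times> (real^'r^'n) \<Rightarrow> real^'r^'n) \<Rightarrow>
     ((real^'n^'m) \<times> (real^'n^'n)) \<times> ((real^'n^'m) \<times> (real^'n^'n)) \<Rightarrow>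
     (real^'n^'m) \<times> (real^'n^'n) \<Rightarrow> bool" where
  "lifted_value \<iota> h RH RSt = (\<lambda>((X, G), (\<eta>, \<zeta>)) Y.
     \<exists>H V K Vp. represents_point \<iota> h H V X G \<and> represents_tangent \<iota> h H V K Vp \<eta> \<zeta> \<and>
       Y = (RH (H, K) ** transpose (RSt (V, Vp)),
            mat 1 - RSt (V, Vp) ** transpose (RSt (V, Vp))))"

text \<open>A description operator is harmless here only where the value exists and is independent of the
  representations; that has to be established for every tangent vector.\<close>

definition lifted_map ::
    "('r \<Rightarrow> 'n) \<Rightarrow> (real^'n^'m \<Rightarrow> real^'q) \<Rightarrow>
     ((real^'r^'m) \<times> (real^'r^'m) \<Rightarrow> real^'r^'m) \<Rightarrow>
     ((real^'r^'n) \<times> (real^'r^'n) \<Rightarrow> real^'r^'n) \<Rightarrow>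
     ((real^'n^'m) \<times> (real^'n^'n)) \<times> ((real^'n^'m) \<times> (real^'n^'n)) \<Rightarrow>
     (real^'n^'m) \<times> (real^'n^'n)" where
  "lifted_map \<iota> h RH RSt x = (THE Y. lifted_value \<iota> h RH RSt x Y)"

end

theory Submission
  imports Defs
begin

text \<open>
  Call a matrix \<open>V\<close> in \<open>stiefel\<close> a frame, and a frame of \<open>G\<close> if \<open>I - G = V V\<^sup>T\<close>. Once a frame of \<open>G\<close>
  is chosen, the equations defining a representation can be solved: multiplying them by \<open>V\<close> from the right gives
  \<open>H = X V\<close>, \<open>K = \<eta> V\<close> and \<open>V\<^sub>p = - \<zeta> V\<close> (\<open>represents_tangent_solve\<close>). Two frames of the same \<open>G\<close>
  differ by the orthogonal factor \<open>Q = V\<^sup>T V'\<close>, so by these formulas all of \<open>H, V, K, V\<^sub>p\<close> change by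
  right multiplication with \<open>Q\<close>. Orthogonal homogeneity passes \<open>Q\<close> on to the two retracted
  matrices, and it cancels in \<open>(A Q) (B Q)\<^sup>T\<close>. Hence the lifted value does not depend on the choices
  (\<open>lifted_value_unique\<close>).

  That the solved quantities do represent a given tangent vector (\<open>frame_represents\<close>) is partly
  algebra: differentiating \<open>G\<^sup>T = G\<close>, \<open>G G = G\<close> and \<open>X G = 0\<close> along a curve gives the linear
  identities needed. The remaining claim is that \<open>\<eta> V\<close> is the velocity of a curve in \<open>Hr\<close>. For a
  curve \<open>(x(t), g(t))\<close> such a curve is \<open>x(t) v(t)\<close>, where \<open>v(t)\<close> is a smooth curve of frames of
  \<open>g(t)\<close> starting at \<open>V\<close>; it lies in \<open>Hr\<close> because an orthogonal matrix carries any frame to the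
  coordinate frame used for padding (\<open>invariant_pad_columns\<close>).

  Smooth frames come from one map \<open>N\<close> (\<open>smooth_orthonormalization\<close>), a form of the Gram-Schmidt
  process: it is smooth near the Stiefel manifold, fixes frames, changes a matrix only by a right
  factor, and its derivative at a frame \<open>V\<close> fixes every \<open>w\<close> with \<open>V\<^sup>T w = 0\<close>. If \<open>V\<close>
  is a frame of \<open>G\<^sub>0\<close>, then \<open>N ((I - G) V)\<close> is a frame of \<open>G\<close> for all \<open>G\<close> in the Grassmannian near
  \<open>G\<^sub>0\<close>. Its composition with the formulas above is smooth on an open set of the ambient space, so the lifted
  map locally is a restriction of a smooth map (\<open>smooth_lifted_map\<close>). The derivative of
  \<open>t \<mapsto> R(x, t \<xi>)\<close> at \<open>0\<close> follows from the product rule, as \<open>(t K, t V\<^sub>p)\<close> represents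
  \<open>t \<xi>\<close>.
\<close>

section \<open>Closure properties of smooth maps\<close>

lemma Ck_on_Suc_has_derivative:
  assumes "Ck_on (Suc k) U f" and "x \<in> U"
  shows "(f has_derivative frechet_derivative f (at x)) (at x)"
  using assms by (simp add: frechet_derivative_works)

lemma Ck_on_cong:
  assumes "open U" and "Ck_on k U f" and "\<And>x. x \<in> U \<Longrightarrow> f x = g x"
  shows "Ck_on k U g"
  using assms(2,3)
proof (induction k arbitrary: f g)
  case 0
  then show ?case by (simp cong: continuous_on_cong)
next
  case (Suc k)
  have der: "(g has_derivative frechet_derivative f (at x)) (at x)" if "x \<in> U" for x
    by (rule has_derivative_transform_within_open[OF
          Ck_on_Suc_has_derivative[OF Suc.prems(1) that] \<open>open U\<close> that Suc.prems(2)])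
  have "Ck_on k U (\<lambda>x. frechet_derivative g (at x) v)" for v
  proof (rule Suc.IH)
    show "Ck_on k U (\<lambda>x. frechet_derivative f (at x) v)"
      using Suc.prems(1) by simp
  qed (simp add: frechet_derivative_at[OF der])
  then show ?case
    using der by (auto simp: differentiable_def)
qed

text \<open>A formula for the derivative suffices; the choice made by \<open>frechet_derivative\<close> need not be evaluated.\<close>

lemma Ck_on_SucI:
  assumes "open U" and "\<And>x. x \<in> U \<Longrightarrow> (f has_derivative f' x) (at x)"
    and "\<And>v. Ck_on k U (\<lambda>x. f' x v)"
  shows "Ck_on (Suc k) U f"
proof -
  have "Ck_on k U (\<lambda>x. frechet_derivative f (at x) v)" for v
    by (rule Ck_on_cong[OF assms(1) assms(3)[of v]])
       (simp add: frechet_derivative_at[OF assms(2), symmetric])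
  then show ?thesis
    using assms(2) by (auto simp: differentiable_def)
qed

lemma Ck_on_Suc_D: "Ck_on (Suc k) U f \<Longrightarrow> Ck_on k U f"
proof (induction k arbitrary: f)
  case 0
  then show ?case
    by (auto intro!: continuous_at_imp_continuous_on differentiable_imp_continuous_within)
next
  case (Suc k)
  then show ?case by (metis Ck_on.simps(2))
qed

lemma Ck_on_imp_continuous_on: "Ck_on k U f \<Longrightarrow> continuous_on U f"
  by (induction k) (auto dest: Ck_on_Suc_D simp del: Ck_on.simps(2))

lemma Ck_on_subset: "Ck_on k U f \<Longrightarrow> V \<subseteq> U \<Longrightarrow> Ck_on k V f"
  by (induction k arbitrary: f) (auto intro: continuous_on_subset)

lemma Ck_on_const: "open U \<Longrightarrow> Ck_on k U (\<lambda>x. c)"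
proof (induction k arbitrary: c)
  case (Suc k)
  show ?case
    by (rule Ck_on_SucI[where f' = "\<lambda>_ _. 0"]) (auto intro: Suc)
qed simp

lemma Ck_on_bounded_linear:
  assumes "open U" and "bounded_linear L"
  shows "Ck_on k U L"
proof (cases k)
  case 0
  then show ?thesis
    using assms by (simp add: linear_continuous_on)
next
  case (Suc j)
  then show ?thesis
    using assms
    by (simp only:) (rule Ck_on_SucI[where f' = "\<lambda>_. L"],
        auto intro: Ck_on_const bounded_linear_imp_has_derivative)
qed

lemma Ck_on_add:
  assumes "open U" and "Ck_on k U f" and "Ck_on k U g"
  shows "Ck_on k U (\<lambda>x. f x + g x)"
  using assms(2,3)
proof (induction k arbitrary: f g)
  case 0
  then show ?case by (simp add: continuous_on_add)
next
  case (Suc k)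
  show ?case
  proof (rule Ck_on_SucI[OF assms(1)])
    show "((\<lambda>x. f x + g x) has_derivative
        (\<lambda>v. frechet_derivative f (at x) v + frechet_derivative g (at x) v)) (at x)"
      if "x \<in> U" for x
      by (intro has_derivative_add Ck_on_Suc_has_derivative[OF Suc.prems(1) that]
          Ck_on_Suc_has_derivative[OF Suc.prems(2) that])
    show "Ck_on k U (\<lambda>x. frechet_derivative f (at x) v + frechet_derivative g (at x) v)" for v
      by (rule Suc.IH) (use Suc.prems in auto)
  qed
qed

lemma Ck_on_sum:
  assumes "open U" and "\<And>i. i \<in> I \<Longrightarrow> Ck_on k U (f i)"
  shows "Ck_on k U (\<lambda>x. \<Sum>i\<in>I. f i x)"
  using assms(2)
  by (induction I rule: infinite_finite_induct)
     (auto intro: Ck_on_const Ck_on_add assms(1))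

lemma Ck_on_bilinear:
  assumes "open U" and "bounded_bilinear p" and "Ck_on k U f" and "Ck_on k U g"
  shows "Ck_on k U (\<lambda>x. p (f x) (g x))"
  using assms(3,4)
proof (induction k arbitrary: f g)
  case 0
  then show ?case using bounded_bilinear.continuous_on[OF assms(2)] by simp
next
  case (Suc k)
  let ?f' = "\<lambda>x. frechet_derivative f (at x)" and ?g' = "\<lambda>x. frechet_derivative g (at x)"
  show ?case
  proof (rule Ck_on_SucI[OF assms(1)])
    show "((\<lambda>x. p (f x) (g x)) has_derivative (\<lambda>v. p (f x) (?g' x v) + p (?f' x v) (g x))) (at x)"
      if "x \<in> U" for x
      by (rule bounded_bilinear.FDERIV[OF assms(2) Ck_on_Suc_has_derivative[OF Suc.prems(1) that]
            Ck_on_Suc_has_derivative[OF Suc.prems(2) that]])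
    show "Ck_on k U (\<lambda>x. p (f x) (?g' x v) + p (?f' x v) (g x))" for v
      by (intro Ck_on_add[OF assms(1)] Suc.IH) (use Suc.prems Ck_on_Suc_D in auto)
  qed
qed

lemma Ck_on_compose:
  fixes f :: "'a::euclidean_space \<Rightarrow> 'b::euclidean_space"
    and g :: "'b \<Rightarrow> 'c::real_normed_vector"
  assumes "open U" and "Ck_on k U f" and "Ck_on k V g" and "f ` U \<subseteq> V"
  shows "Ck_on k U (\<lambda>x. g (f x))"
  using assms(2,3)
proof (induction k arbitrary: g)
  case 0
  then show ?case using assms(4) by (simp add: continuous_on_compose2)
next
  case (Suc k)
  let ?f' = "\<lambda>x. frechet_derivative f (at x)" and ?g' = "\<lambda>y. frechet_derivative g (at y)"
  have lin: "linear (?g' y)" if "y \<in> V" for y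
    using Ck_on_Suc_has_derivative[OF Suc.prems(2) that]
    by (rule has_derivative_linear)
  show ?case
  proof (rule Ck_on_SucI[OF assms(1)])
    show "((\<lambda>x. g (f x)) has_derivative (\<lambda>v. \<Sum>b\<in>Basis. (?f' x v \<bullet> b) *\<^sub>R ?g' (f x) b)) (at x)"
      if x: "x \<in> U" for x
    proof -
      have y: "f x \<in> V"
        using x assms(4) by auto
      have "((\<lambda>x. g (f x)) has_derivative (\<lambda>v. ?g' (f x) (?f' x v))) (at x)"
        by (rule has_derivative_compose[OF Ck_on_Suc_has_derivative[OF Suc.prems(1) x]
              Ck_on_Suc_has_derivative[OF Suc.prems(2) y]])
      \<comment> \<open>Expanding in a basis separates the base point \<open>f x\<close> from the direction \<open>?f' x v\<close>, which both
        vary with \<open>x\<close>: the maps \<open>?g' (f x) b\<close> with \<open>b\<close> fixed are covered by the induction hypothesis.\<close>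
      moreover have "?g' (f x) (?f' x v) = (\<Sum>b\<in>Basis. (?f' x v \<bullet> b) *\<^sub>R ?g' (f x) b)" for v
        using linear_sum[OF lin[OF y]] linear_scale[OF lin[OF y]]
        by (metis (mono_tags, lifting) euclidean_representation sum.cong)
      ultimately show ?thesis by simp
    qed
    show "Ck_on k U (\<lambda>x. \<Sum>b\<in>Basis. (?f' x v \<bullet> b) *\<^sub>R ?g' (f x) b)" for v
    proof (intro Ck_on_sum[OF assms(1)] Ck_on_bilinear[OF assms(1) bounded_bilinear_scaleR])
      fix b :: 'b
      show "Ck_on k U (\<lambda>x. ?f' x v \<bullet> b)"
        by (rule Ck_on_bilinear[OF assms(1) bounded_bilinear_inner])
           (use Suc.prems(1) in \<open>auto intro: Ck_on_const assms(1)\<close>)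
      show "Ck_on k U (\<lambda>x. ?g' (f x) b)"
        by (rule Suc.IH) (use Suc.prems Ck_on_Suc_D in auto)
    qed
  qed
qed

text \<open>All exponents are treated at once, since differentiating lowers the exponent.\<close>

lemma Ck_on_powr: "Ck_on k {0<..} (\<lambda>s::real. s powr a)"
proof (induction k arbitrary: a)
  case 0
  show ?case by (auto intro!: continuous_intros)
next
  case (Suc k)
  show ?case
  proof (rule Ck_on_SucI[where f' = "\<lambda>s v. v * (a * s powr (a - 1))"])
    show "((\<lambda>s. s powr a) has_derivative (\<lambda>v. v * (a * s powr (a - 1)))) (at s)"
      if "s \<in> {0<..}" for s :: real
      using has_real_derivative_powr[of s a] that
      by (simp add: has_field_derivative_def mult.commute mult_commute_abs)
    show "Ck_on k {0<..} (\<lambda>s. v * (a * s powr (a - 1)))" for v :: real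
      by (intro Ck_on_bilinear[OF _ bounded_bilinear_mult] Ck_on_const Suc) auto
  qed auto
qed

lemma smooth_const: "open U \<Longrightarrow> smooth_on_open U (\<lambda>x. c)"
  by (simp add: smooth_on_open_def Ck_on_const)

lemma smooth_ident: "open U \<Longrightarrow> smooth_on_open U (\<lambda>x. x)"
  by (simp add: smooth_on_open_def Ck_on_bounded_linear bounded_linear_ident)

lemma smooth_add:
  "smooth_on_open U f \<Longrightarrow> smooth_on_open U g \<Longrightarrow> smooth_on_open U (\<lambda>x. f x + g x)"
  by (simp add: smooth_on_open_def Ck_on_add)

lemma smooth_sum:
  assumes "open U" and "\<And>i. i \<in> I \<Longrightarrow> smooth_on_open U (f i)"
  shows "smooth_on_open U (\<lambda>x. \<Sum>i\<in>I. f i x)"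
  using assms by (simp add: smooth_on_open_def Ck_on_sum)

lemma smooth_bilinear:
  "bounded_bilinear p \<Longrightarrow> smooth_on_open U f \<Longrightarrow> smooth_on_open U g \<Longrightarrow>
    smooth_on_open U (\<lambda>x. p (f x) (g x))"
  by (simp add: smooth_on_open_def Ck_on_bilinear)

lemma smooth_on_open_open: "smooth_on_open U f \<Longrightarrow> open U"
  by (simp add: smooth_on_open_def)

lemma smooth_subset:
  "smooth_on_open U f \<Longrightarrow> open V \<Longrightarrow> V \<subseteq> U \<Longrightarrow> smooth_on_open V f"
  unfolding smooth_on_open_def using Ck_on_subset by blast

lemma smooth_imp_continuous_on: "smooth_on_open U f \<Longrightarrow> continuous_on U f"
  unfolding smooth_on_open_def using Ck_on_imp_continuous_on by blast

lemma smooth_imp_has_derivative: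
  "smooth_on_open U f \<Longrightarrow> x \<in> U \<Longrightarrow> (f has_derivative frechet_derivative f (at x)) (at x)"
  unfolding smooth_on_open_def by (metis Ck_on_Suc_has_derivative)

lemma open_smooth_preimage:
  "smooth_on_open U f \<Longrightarrow> open V \<Longrightarrow> open (U \<inter> f -` V)"
  by (simp add: continuous_open_preimage smooth_imp_continuous_on smooth_on_open_open)

lemma smooth_compose:
  fixes f :: "'a::euclidean_space \<Rightarrow> 'b::euclidean_space"
  assumes "smooth_on_open V g" and "smooth_on_open U f" and "f ` U \<subseteq> V"
  shows "smooth_on_open U (\<lambda>x. g (f x))"
  using assms Ck_on_compose unfolding smooth_on_open_def by blast

lemma smooth_bounded_linear:
  assumes "bounded_linear L" and "smooth_on_open U f"
  shows "smooth_on_open U (\<lambda>x. L (f x))"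
proof -
  interpret bounded_linear L by fact
  have "bounded_bilinear (\<lambda>(c::real) x. c *\<^sub>R L x)"
    by (rule bounded_bilinear.comp[OF bounded_bilinear_scaleR bounded_linear_ident assms(1)])
  from smooth_bilinear[OF this smooth_const[of U 1] assms(2)] show ?thesis
    using smooth_on_open_open[OF assms(2)] by simp
qed

lemma smooth_Pair:
  fixes f :: "'a::euclidean_space \<Rightarrow> 'b::real_normed_vector" and g :: "'a \<Rightarrow> 'c::real_normed_vector"
  assumes "smooth_on_open U f" and "smooth_on_open U g"
  shows "smooth_on_open U (\<lambda>x. (f x, g x))"
proof -
  have "bounded_linear (\<lambda>x. (x, 0::'c))" "bounded_linear (\<lambda>y. (0::'b, y))"
    by (auto intro!: bounded_linear_intros)
  with assms have "smooth_on_open U (\<lambda>x. (f x, 0) + (0, g x))"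
    by (intro smooth_add smooth_bounded_linear[of "\<lambda>x. (x, 0::'c)"]
        smooth_bounded_linear[of "\<lambda>y. (0::'b, y)"])
  then show ?thesis by simp
qed

lemma bounded_bilinear_matrix_mult:
  "bounded_bilinear ((**) :: real^'b^'a \<Rightarrow> real^'c^'b \<Rightarrow> real^'c^'a)"
proof -
  have "bilinear ((**) :: real^'b^'a \<Rightarrow> real^'c^'b \<Rightarrow> real^'c^'a)"
    unfolding bilinear_def
    by (auto intro!: linearI
        simp: matrix_matrix_mult_def vec_eq_iff algebra_simps sum.distrib sum_distrib_left)
  then show ?thesis by (simp add: bilinear_conv_bounded_bilinear)
qed

lemma bounded_linear_transpose: "bounded_linear (transpose :: real^'b^'a \<Rightarrow> real^'a^'b)"
  by (rule linear_conv_bounded_linear[THEN iffD1], rule linearI)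
     (auto simp: transpose_def vec_eq_iff)

lemmas smooth_matrix_mult = smooth_bilinear[OF bounded_bilinear_matrix_mult]
lemmas smooth_transpose = smooth_bounded_linear[OF bounded_linear_transpose]
lemmas smooth_fst = smooth_bounded_linear[OF bounded_linear_fst]
lemmas smooth_snd = smooth_bounded_linear[OF bounded_linear_snd]

lemma smooth_uminus: "smooth_on_open U f \<Longrightarrow> smooth_on_open U (\<lambda>x. - f x)"
  by (rule smooth_bounded_linear[OF bounded_linear_minus[OF bounded_linear_ident]])

lemma smooth_diff:
  "smooth_on_open U f \<Longrightarrow> smooth_on_open U g \<Longrightarrow> smooth_on_open U (\<lambda>x. f x - g x)"
  using smooth_add[OF _ smooth_uminus] by fastforce

lemma smooth_nth: "smooth_on_open U f \<Longrightarrow> smooth_on_open U (\<lambda>x. f x $ i)"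
  by (rule smooth_bounded_linear[OF bounded_linear_vec_nth])

lemma smooth_vec_lambda:
  fixes f :: "'i::finite \<Rightarrow> 'a::euclidean_space \<Rightarrow> 'b::real_normed_vector"
  assumes "open U" and "\<And>i. smooth_on_open U (f i)"
  shows "smooth_on_open U (\<lambda>x. \<chi> i. f i x)"
proof -
  have lin: "bounded_linear (axis i :: 'b \<Rightarrow> 'b^'i)" for i
    by (rule bounded_linear_intro[where K = 1])
       (auto simp: axis_def vec_eq_iff norm_vec_def L2_set_def if_distrib[of norm]
         if_distrib[of "\<lambda>x. x ^ 2"] cong: if_cong)
  have "smooth_on_open U (\<lambda>x. \<Sum>i\<in>UNIV. axis i (f i x))"
    by (intro smooth_sum assms(1) smooth_bounded_linear[OF lin] assms(2))
  moreover have "(\<Sum>i\<in>UNIV. axis i (f i x)) = (\<chi> i. f i x)" for x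
    by (simp add: vec_eq_iff axis_def)
  ultimately show ?thesis by simp
qed

section \<open>Smooth orthonormalization\<close>

text \<open>The product of a vector \<open>x\<close> with column \<open>k\<close> of the matrix \<open>E\<close> of the next lemma.\<close>

lemma sum_elementary_column:
  fixes x b :: "'r::finite \<Rightarrow> real"
  assumes "k \<notin> S"
  shows "(\<Sum>q\<in>UNIV. x q * ((if q = k then 1 else if q \<in> S then - b q else 0) * c)) =
    c * (x k - (\<Sum>q\<in>S. x q * b q))"
proof -
  have "(\<Sum>q\<in>UNIV. x q * ((if q = k then 1 else if q \<in> S then - b q else 0) * c)) =
      (\<Sum>q\<in>UNIV. (if q = k then c * x q else 0) - (if q \<in> S then c * (x q * b q) else 0))"
    using assms by (intro sum.cong) auto
  also have "\<dots> = c * x k - (\<Sum>q\<in>S. c * (x q * b q))"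
    by (simp add: sum_subtractf sum.If_cases)
  finally show ?thesis
    by (simp add: right_diff_distrib sum_distrib_left)
qed

text \<open>One Gram-Schmidt step for the symmetric form \<open>B\<close>. The matrix \<open>E\<close> replaces the coordinate vector
  \<open>e\<^sub>k\<close> by \<open>c (e\<^sub>k - (\<Sum>q\<in>S. B\<^sub>q\<^sub>k e\<^sub>q))\<close>. Subtracting the sum makes it \<open>B\<close>-orthogonal to the
  \<open>e\<^sub>q\<close> with \<open>q \<in> S\<close>, and \<open>s\<close> is the \<open>B\<close>-square of the difference, so \<open>c\<close> normalizes it.\<close>

lemma gram_schmidt_step:
  fixes B :: "real^'r^'r"
  assumes sym: "transpose B = B"
    and orth: "\<And>i j. i \<in> S \<Longrightarrow> j \<in> S \<Longrightarrow> B $ i $ j = (if i = j then 1 else 0)"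
    and k: "k \<notin> S"
    and s: "s = B $ k $ k - (\<Sum>q\<in>S. B $ q $ k * B $ q $ k)" "s > 0"
    and c: "c = s powr (- 1 / 2)"
    and E: "E = (\<chi> i j. if j = k then (if i = k then 1 else if i \<in> S then - (B $ i $ k) else 0) * c
                          else if i = j then 1 else 0)"
    and ij: "i \<in> insert k S" "j \<in> insert k S"
  shows "(transpose E ** B ** E) $ i $ j = (if i = j then 1 else 0)"
proof -
  have symB: "B $ i $ j = B $ j $ i" for i j
    using arg_cong[OF sym, of "\<lambda>M. M $ j $ i"] by (simp add: transpose_def)
  have pick: "(\<Sum>q\<in>S. y q * B $ q $ p) = y p" if "p \<in> S" for p y
  proof -
    have "(\<Sum>q\<in>S. y q * B $ q $ p) = (\<Sum>q\<in>S. if q = p then y q else 0)"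
      using that by (intro sum.cong) (auto simp: orth)
    then show ?thesis using that by (simp add: sum.delta')
  qed
  have BE: "(B ** E) $ p $ j = (if j = k then c * (B $ p $ k - (\<Sum>q\<in>S. B $ p $ q * B $ q $ k))
      else B $ p $ j)" for p j
  proof (cases "j = k")
    case True
    then show ?thesis
      using sum_elementary_column[OF k, of "\<lambda>q. B $ p $ q" "\<lambda>q. B $ q $ k" c]
      by (simp add: matrix_matrix_mult_def E)
  next
    case False
    then show ?thesis by (simp add: matrix_matrix_mult_def E if_distrib[of "(*) _"] cong: if_cong)
  qed
  have EBE: "(transpose E ** M) $ i $ j =
      (if i = k then c * (M $ k $ j - (\<Sum>q\<in>S. M $ q $ j * B $ q $ k)) else M $ i $ j)"
    for M :: "real^'r^'r" and i j
  proof (cases "i = k")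
    case True
    then show ?thesis
      using sum_elementary_column[OF k, of "\<lambda>q. M $ q $ j" "\<lambda>q. B $ q $ k" c]
      by (simp add: matrix_matrix_mult_def transpose_def E mult.commute[of _ "M $ _ $ _"])
  next
    case False
    then show ?thesis
      by (simp add: matrix_matrix_mult_def transpose_def E if_distrib[of "\<lambda>x. x * _"] cong: if_cong)
  qed
  have BEk: "(B ** E) $ p $ k = 0" if "p \<in> S" for p
  proof -
    have "(\<Sum>q\<in>S. B $ p $ q * B $ q $ k) = (\<Sum>q\<in>S. B $ q $ k * B $ q $ p)"
      by (simp add: symB[of p] mult.commute)
    then show ?thesis using pick[OF that, of "\<lambda>q. B $ q $ k"] by (simp add: BE)
  qed
  have BEkk: "(B ** E) $ k $ k = c * s"
    using sum.cong[OF refl, of S "\<lambda>q. B $ k $ q * B $ q $ k" "\<lambda>q. B $ q $ k * B $ q $ k"] symB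
    by (simp add: BE s(1))
  have cs: "c * (c * s) = 1"
  proof -
    have "c * c = s powr (- 1)"
      unfolding c by (simp flip: powr_add)
    with s(2) show ?thesis by (simp add: powr_minus flip: mult.assoc)
  qed
  have E2: "(transpose E ** B ** E) $ i $ j = (transpose E ** (B ** E)) $ i $ j" for i j
    by (simp add: matrix_mul_assoc)
  consider "i = k" "j = k" | "i = k" "j \<in> S" "j \<noteq> k" | "i \<in> S" "i \<noteq> k" "j = k"
    | "i \<in> S" "i \<noteq> k" "j \<in> S" "j \<noteq> k"
    using ij k by auto
  then show ?thesis
  proof cases
    case 1
    then show ?thesis by (simp add: E2 EBE BEk BEkk cs)
  next
    case 2
    have "(\<Sum>q\<in>S. B $ q $ j * B $ q $ k) = B $ j $ k"
      using pick[OF 2(2), of "\<lambda>q. B $ q $ k"] by (simp add: mult.commute)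
    with 2 show ?thesis by (simp add: E2 EBE BE symB[of k j])
  next
    case 3
    then show ?thesis by (simp add: E2 EBE BEk)
  next
    case 4
    then show ?thesis by (simp add: E2 EBE BE orth)
  qed
qed

text \<open>A symmetric matrix \<open>A\<close> near the identity is congruent to the identity by a factor \<open>f A\<close> that depends
  smoothly on \<open>A\<close>; here the congruence is asked for only on the block with indices in \<open>S\<close>.
  Adding one index at a time to \<open>S\<close> makes each step an explicit formula that involves only arithmetic
  and one inverse square root.\<close>

lemma smooth_partial_congruence:
  fixes S :: "'r::finite set"
  shows "\<exists>U (f :: real^'r^'r \<Rightarrow> real^'r^'r). smooth_on_open U f \<and> mat 1 \<in> U \<and> f (mat 1) = mat 1 \<and>
    (\<forall>A\<in>U. transpose A = A \<longrightarrow>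
      (\<forall>i\<in>S. \<forall>j\<in>S. (transpose (f A) ** A ** f A) $ i $ j = (if i = j then 1 else 0)))"
  using finite[of S]
proof (induction S)
  case empty
  show ?case
    by (rule exI[of _ UNIV], rule exI[of _ "\<lambda>_. mat 1"]) (simp add: smooth_const)
next
  case (insert k S)
  then obtain U and f :: "real^'r^'r \<Rightarrow> real^'r^'r" where f: "smooth_on_open U f" "mat 1 \<in> U"
      "f (mat 1) = mat 1"
    and orth: "\<And>A i j. A \<in> U \<Longrightarrow> transpose A = A \<Longrightarrow> i \<in> S \<Longrightarrow> j \<in> S \<Longrightarrow>
      (transpose (f A) ** A ** f A) $ i $ j = (if i = j then 1 else 0)"
    by blast
  define B where "B = (\<lambda>A. transpose (f A) ** A ** f A)"
  define s where "s = (\<lambda>A. B A $ k $ k - (\<Sum>q\<in>S. B A $ q $ k * B A $ q $ k))"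
  \<comment> \<open>\<open>s\<close> takes the value 1 at the identity, so this is still a neighbourhood of the identity.\<close>
  define U' where "U' = U \<inter> s -` {0<..}"
  define c where "c = (\<lambda>A. s A powr (- 1 / 2))"
  define E where "E = (\<lambda>A. (\<chi> i j.
    if j = k then (if i = k then 1 else if i \<in> S then - (B A $ i $ k) else 0) * c A
    else if i = j then 1 else 0) :: real^'r^'r)"
  have "open U"
    using f(1) by (rule smooth_on_open_open)
  have B: "smooth_on_open U B"
    unfolding B_def by (intro smooth_matrix_mult smooth_transpose f smooth_ident \<open>open U\<close>)
  have s: "smooth_on_open U s"
    unfolding s_def
    by (intro smooth_diff smooth_sum smooth_bilinear[OF bounded_bilinear_mult] smooth_nth B \<open>open U\<close>)
  have "open U'"
    unfolding U'_def by (rule open_smooth_preimage[OF s]) simp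
  have "U' \<subseteq> U"
    by (auto simp: U'_def)
  have c: "smooth_on_open U' c"
    unfolding c_def
  proof (rule smooth_compose[where V = "{0<..}" and g = "\<lambda>s. s powr (- 1 / 2)" and f = s])
    show "smooth_on_open {0<..} (\<lambda>s::real. s powr (- 1 / 2))"
      by (simp add: smooth_on_open_def Ck_on_powr)
  qed (auto simp: U'_def intro: smooth_subset[OF s \<open>open U'\<close>[unfolded U'_def]])
  have "smooth_on_open U' E"
    unfolding E_def
  proof (intro smooth_vec_lambda \<open>open U'\<close>)
    fix i j
    show "smooth_on_open U' (\<lambda>A. if j = k
        then (if i = k then 1 else if i \<in> S then - (B A $ i $ k) else 0) * c A
        else if i = j then 1 else 0)"
    proof (cases "j = k")
      case True
      have "smooth_on_open U' (\<lambda>A. if i = k then 1 else if i \<in> S then - (B A $ i $ k) else 0)"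
        using smooth_const[OF \<open>open U'\<close>, where 'b = real]
          smooth_uminus[OF smooth_nth[OF smooth_nth[OF smooth_subset[OF B \<open>open U'\<close> \<open>U' \<subseteq> U\<close>]]]]
        by (cases "i = k"; cases "i \<in> S") simp_all
      with True c show ?thesis
        by (simp add: smooth_bilinear[OF bounded_bilinear_mult])
    qed (simp add: smooth_const \<open>open U'\<close>)
  qed
  then have f': "smooth_on_open U' (\<lambda>A. f A ** E A)"
    by (intro smooth_matrix_mult smooth_subset[OF f(1) \<open>open U'\<close> \<open>U' \<subseteq> U\<close>])
  have B1: "B (mat 1) = mat 1"
    by (simp add: B_def f)
  have s1: "s (mat 1) = 1"
  proof -
    have "(\<Sum>q\<in>S. mat 1 $ q $ k * mat 1 $ q $ k) = (0::real)"
      using insert.hyps(2) by (intro sum.neutral) (auto simp: mat_def)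
    then show ?thesis by (simp add: s_def B1) (simp add: mat_def)
  qed
  have "E (mat 1) = mat 1"
    using insert.hyps(2) by (auto simp: E_def B1 c_def s1 vec_eq_iff) (auto simp: mat_def)
  moreover have "(transpose (f A ** E A) ** A ** (f A ** E A)) $ i $ j = (if i = j then 1 else 0)"
    if "A \<in> U'" "transpose A = A" "i \<in> insert k S" "j \<in> insert k S" for A i j
  proof -
    have "transpose (f A ** E A) ** A ** (f A ** E A) = transpose (E A) ** B A ** E A"
      by (simp add: B_def matrix_transpose_mul matrix_mul_assoc)
    moreover have "(transpose (E A) ** B A ** E A) $ i $ j = (if i = j then 1 else 0)"
    proof (rule gram_schmidt_step[OF _ _ insert.hyps(2) _ _ _ _ that(3,4), of "B A" "s A" "c A"])
      show "transpose (B A) = B A"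
        using that(2) by (simp add: B_def matrix_transpose_mul matrix_mul_assoc)
    qed (use that(1,2) in \<open>auto simp: orth B_def s_def c_def E_def U'_def\<close>)
    ultimately show ?thesis by simp
  qed
  ultimately show ?case
    using f f' s1 by (intro exI[of _ U'] exI[of _ "\<lambda>A. f A ** E A"]) (auto simp: U'_def)
qed

text \<open>With \<open>f\<close> as in the preceding lemma for all indices, \<open>N W = W f(W\<^sup>T W)\<close>. If \<open>V\<^sup>T w = 0\<close>, the Gram matrix
  \<open>W\<^sup>T W\<close> is stationary at \<open>V\<close> in the direction \<open>w\<close>, so only the factor \<open>W\<close> contributes to the
  derivative of \<open>N\<close>, which therefore fixes \<open>w\<close>.\<close>

lemma smooth_orthonormalization:
  obtains U and N :: "real^'r^'n \<Rightarrow> real^'r^'n"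
  where "smooth_on_open U N" and "stiefel \<subseteq> U"
    and "\<And>W. W \<in> U \<Longrightarrow> N W \<in> stiefel" and "\<And>W. W \<in> U \<Longrightarrow> \<exists>C. N W = W ** C"
    and "\<And>V. V \<in> stiefel \<Longrightarrow> N V = V"
    and "\<And>V w. V \<in> stiefel \<Longrightarrow> transpose V ** w = 0 \<Longrightarrow> frechet_derivative N (at V) w = w"
proof -
  obtain U and f :: "real^'r^'r \<Rightarrow> real^'r^'r" where f: "smooth_on_open U f" "mat 1 \<in> U"
      "f (mat 1) = mat 1"
    and entries: "\<And>A i j. A \<in> U \<Longrightarrow> transpose A = A \<Longrightarrow>
      (transpose (f A) ** A ** f A) $ i $ j = (if i = j then 1 else 0)"
    using smooth_partial_congruence[of "UNIV :: 'r set"] by blast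
  have orth: "transpose (f A) ** A ** f A = mat 1" if "A \<in> U" "transpose A = A" for A
    using entries[OF that] by (simp add: vec_eq_iff mat_def)
  define gram :: "real^'r^'n \<Rightarrow> real^'r^'r" where "gram = (\<lambda>W. transpose W ** W)"
  define N where "N = (\<lambda>W. W ** f (gram W))"
  define U' where "U' = UNIV \<inter> gram -` U"
  have gram: "smooth_on_open UNIV gram"
    unfolding gram_def by (intro smooth_matrix_mult smooth_transpose smooth_ident open_UNIV)
  have "open U'"
    unfolding U'_def by (rule open_smooth_preimage[OF gram smooth_on_open_open[OF f(1)]])
  have smooth: "smooth_on_open U' N"
    unfolding N_def
  proof (intro smooth_matrix_mult smooth_ident \<open>open U'\<close>)
    show "smooth_on_open U' (\<lambda>W. f (gram W))"
      by (rule smooth_compose[OF f(1) smooth_subset[OF gram \<open>open U'\<close>]]) (auto simp: U'_def)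
  qed
  have sub: "stiefel \<subseteq> U'"
    using f(2) by (auto simp: stiefel_def U'_def gram_def)
  have fixed: "N V = V" if "V \<in> stiefel" for V
    using that f(3) by (simp add: stiefel_def N_def gram_def)
  have "N W \<in> stiefel" if "W \<in> U'" for W
    using orth[of "gram W"] that
    by (simp add: stiefel_def N_def U'_def gram_def matrix_transpose_mul matrix_mul_assoc)
  moreover have "frechet_derivative N (at V) w = w"
    if V: "V \<in> stiefel" and w: "transpose V ** w = 0" for V w
  proof -
    have gV: "gram V = mat 1"
      using V by (simp add: stiefel_def gram_def)
    let ?g' = "\<lambda>w. transpose V ** w + transpose w ** V"
    have g: "(gram has_derivative ?g') (at V)"
      unfolding gram_def
      by (rule bounded_bilinear.FDERIV[OF bounded_bilinear_matrix_mult
            bounded_linear_imp_has_derivative[OF bounded_linear_transpose] has_derivative_ident])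
    let ?f' = "frechet_derivative f (at (mat 1))"
    have f': "(f has_derivative ?f') (at (gram V))"
      using smooth_imp_has_derivative[OF f(1,2)] gV by simp
    have "(N has_derivative (\<lambda>w. V ** ?f' (?g' w) + w ** f (gram V))) (at V)"
      unfolding N_def
      by (rule bounded_bilinear.FDERIV[OF bounded_bilinear_matrix_mult has_derivative_ident
            has_derivative_compose[OF g f']])
    then have "frechet_derivative N (at V) = (\<lambda>w. V ** ?f' (?g' w) + w ** f (gram V))"
      by (rule frechet_derivative_at[symmetric])
    moreover have "transpose w ** V = 0"
      using arg_cong[OF w, of transpose] by (simp add: matrix_transpose_mul)
        (simp add: transpose_def vec_eq_iff)
    moreover have "?f' 0 = 0"
      using f' by (intro linear_0 has_derivative_linear) 
    ultimately show ?thesis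
      using w f(3) by (simp add: gV)
  qed
  ultimately show ?thesis
    using that[OF smooth sub] fixed by (auto simp: N_def)
qed

section \<open>Frames and orthogonal projections\<close>

lemmas matrix_mult_algebra =
  bounded_bilinear.add_left[OF bounded_bilinear_matrix_mult]
  bounded_bilinear.add_right[OF bounded_bilinear_matrix_mult]
  bounded_bilinear.diff_left[OF bounded_bilinear_matrix_mult]
  bounded_bilinear.diff_right[OF bounded_bilinear_matrix_mult]
  bounded_bilinear.minus_left[OF bounded_bilinear_matrix_mult]
  bounded_bilinear.minus_right[OF bounded_bilinear_matrix_mult]
  bounded_bilinear.zero_left[OF bounded_bilinear_matrix_mult]
  bounded_bilinear.zero_right[OF bounded_bilinear_matrix_mult]
  bounded_bilinear.scaleR_left[OF bounded_bilinear_matrix_mult]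
  bounded_bilinear.scaleR_right[OF bounded_bilinear_matrix_mult]

lemmas transpose_algebra =
  bounded_linear.linear[OF bounded_linear_transpose, THEN linear_add]
  bounded_linear.linear[OF bounded_linear_transpose, THEN linear_diff]
  bounded_linear.linear[OF bounded_linear_transpose, THEN linear_neg]
  bounded_linear.linear[OF bounded_linear_transpose, THEN linear_0]
  transpose_scalar

text \<open>For an orthogonal projection \<open>G\<close>, the range of \<open>I - G\<close> is the orthogonal complement of the range of
  \<open>G\<close>.\<close>

lemma rank_complementary_projection:
  fixes G :: "real^'n^'n"
  assumes "transpose G = G" and "G ** G = G"
  shows "rank (mat 1 - G) = CARD('n) - rank G"
proof -
  have sym: "(G *v x) \<bullet> y = x \<bullet> (G *v y)" for x y
    by (metis assms(1) dot_lmul_matrix vector_transpose_matrix)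
  have idem: "G *v (G *v x) = G *v x" for x
    by (simp add: matrix_vector_mul_assoc assms(2))
  have "range ((*v) (mat 1 - G)) = {y \<in> UNIV. \<forall>x \<in> range ((*v) G). orthogonal x y}"
  proof (intro set_eqI iffI)
    fix y assume "y \<in> {y \<in> UNIV. \<forall>x \<in> range ((*v) G). orthogonal x y}"
    then have "(G *v (G *v y)) \<bullet> y = 0"
      by (auto simp: orthogonal_def)
    then have "G *v y = 0"
      by (metis sym inner_eq_zero_iff)
    then have "y = (mat 1 - G) *v y"
      by (simp add: matrix_vector_mult_diff_rdistrib)
    then show "y \<in> range ((*v) (mat 1 - G))" by (rule range_eqI)
  qed (auto simp: orthogonal_def sym idem matrix_vector_mult_diff_rdistrib
        matrix_vector_mult_diff_distrib)
  moreover have "dim {y \<in> UNIV. \<forall>x \<in> range ((*v) G). orthogonal x y} + dim (range ((*v) G))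
      = dim (UNIV :: (real^'n) set)"
    by (rule dim_subspace_orthogonal_to_vectors)
       (auto intro: linear_subspace_image matrix_vector_mul_linear)
  ultimately show ?thesis
    by (simp add: rank_dim_range)
qed

lemma rank_frame_projection:
  fixes V :: "real^'r^'n"
  assumes "V \<in> stiefel"
  shows "rank V = CARD('r)" and "rank (V ** transpose V) = CARD('r)"
proof -
  have V: "transpose V ** V = mat 1"
    using assms by (simp add: stiefel_def)
  have "CARD('r) \<le> rank V"
    using rank_mul_le_right[of "transpose V" V] by (simp add: V rank_I)
  moreover have "rank V \<le> CARD('r)"
    using rank_bound[of V] by simp
  ultimately show r: "rank V = CARD('r)" by simp
  have "V ** transpose V ** V = V"
    by (simp add: V flip: matrix_mul_assoc)
  then have "rank V \<le> rank (V ** transpose V)"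
    using rank_mul_le_left[of "V ** transpose V" V] by simp
  moreover have "rank (V ** transpose V) \<le> rank V"
    by (rule rank_mul_le_left)
  ultimately show "rank (V ** transpose V) = CARD('r)"
    using r by simp
qed

lemma frame_projection_idempotent:
  assumes "V \<in> stiefel"
  shows "V ** transpose V ** (V ** transpose V) = V ** transpose V"
  using assms unfolding stiefel_def mem_Collect_eq
  by (metis matrix_mul_assoc matrix_mul_rid)

lemma frame_complement_in_grassmannian:
  fixes V :: "real^'r^'n"
  assumes "V \<in> stiefel"
  shows "mat 1 - V ** transpose V \<in> grassmannian (CARD('n) - CARD('r))"
  using rank_complementary_projection[of "V ** transpose V"] frame_projection_idempotent[OF assms]
  by (simp add: grassmannian_def rank_frame_projection[OF assms] transpose_algebra
      matrix_mult_algebra matrix_transpose_mul)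

text \<open>The range of \<open>V\<close> lies in the range of \<open>I - G\<close>, and both have dimension \<open>CARD('r)\<close>; so the two
  orthogonal projections have the same range.\<close>

lemma frame_projection_eqI:
  fixes V :: "real^'r^'n"
  assumes V: "V \<in> stiefel" and G: "G \<in> grassmannian (CARD('n) - CARD('r))" and GV: "G ** V = 0"
  shows "mat 1 - G = V ** transpose V"
proof -
  define P where "P = mat 1 - G"
  have P: "transpose P = P" "P ** V = V"
    using G GV by (simp_all add: P_def grassmannian_def transpose_algebra matrix_mult_algebra)
  have VV: "transpose V ** V = mat 1"
    using V by (simp add: stiefel_def)
  have "CARD('r) \<le> CARD('n)"
    using rank_bound[of V] by (simp add: rank_frame_projection[OF V])
  then have "rank P = CARD('r)"
    using G rank_complementary_projection[of G] by (simp add: P_def grassmannian_def)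
  moreover have "range ((*v) V) \<subseteq> range ((*v) P)"
  proof
    fix y assume "y \<in> range ((*v) V)"
    then obtain x where "y = V *v x" by auto
    then have "y = P *v (V *v x)"
      by (simp add: matrix_vector_mul_assoc P)
    then show "y \<in> range ((*v) P)" by (rule range_eqI)
  qed
  ultimately have range_eq: "range ((*v) V) = range ((*v) P)"
    by (intro subspace_dim_equal)
       (auto simp: rank_frame_projection[OF V] simp flip: rank_dim_range
         intro: linear_subspace_image matrix_vector_mul_linear)
  have "V ** transpose V ** P = P"
  proof -
    have "(V ** transpose V ** P) *v x = P *v x" for x
    proof -
      obtain y where y: "P *v x = V *v y"
        using range_eq by blast
      have "(V ** transpose V ** P) *v x = (V ** (transpose V ** V)) *v y"
        by (simp only: y flip: matrix_vector_mul_assoc matrix_mul_assoc)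
      then show ?thesis by (simp add: VV y)
    qed
    then show ?thesis by (simp add: matrix_eq)
  qed
  moreover have "V ** transpose V ** P = V ** transpose V"
    using arg_cong[OF P(2), of transpose] P(1)
    by (simp add: matrix_transpose_mul flip: matrix_mul_assoc)
  ultimately show ?thesis by (simp add: P_def)
qed

lemma frame_exists:
  fixes G :: "real^'n^'n"
  assumes G: "G \<in> grassmannian (CARD('n) - CARD('r::finite))" and le: "CARD('r) \<le> CARD('n)"
  obtains V :: "real^'r^'n" where "V \<in> stiefel" and "mat 1 - G = V ** transpose V"
proof -
  let ?S = "range ((*v) (mat 1 - G))"
  have "dim ?S = CARD('r)"
    using rank_complementary_projection[of G] G le by (simp add: grassmannian_def rank_dim_range)
  moreover have "subspace ?S"
    by (auto intro: linear_subspace_image matrix_vector_mul_linear)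
  ultimately obtain B where B: "B \<subseteq> ?S" "pairwise orthogonal B" "\<And>x. x \<in> B \<Longrightarrow> norm x = 1"
      "independent B" "card B = CARD('r)"
    using orthonormal_basis_subspace by metis
  have "finite B"
    using B(4) by (rule independent_imp_finite)
  then obtain b :: "'r \<Rightarrow> real^'n" where b: "bij_betw b UNIV B"
    using B(5) by (metis finite_same_card_bij finite_class.finite_UNIV)
  define V :: "real^'r^'n" where "V = (\<chi> i j. b j $ i)"
  have col: "column j V = b j" for j
    by (simp add: V_def column_def vec_eq_iff)
  have bB: "b j \<in> B" for j
    using b by (auto simp: bij_betw_def)
  have "b i \<bullet> b j = (if i = j then 1 else 0)" for i j
  proof (cases "i = j")
    case True
    then show ?thesis using B(3)[OF bB] by (simp add: norm_eq_1)
  next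
    case False
    then have "b i \<noteq> b j"
      using b by (auto simp: bij_betw_def inj_def)
    with False show ?thesis
      using B(2) bB by (auto simp: pairwise_def orthogonal_def)
  qed
  then have "V \<in> stiefel"
    by (simp add: stiefel_def matrix_mult_transpose_dot_column col vec_eq_iff mat_def)
  moreover have "G ** V = 0"
  proof -
    have "G *v b j = 0" for j
    proof -
      obtain x where "b j = (mat 1 - G) *v x"
        using bB B(1) by blast
      then have "G *v b j = (G ** (mat 1 - G)) *v x"
        by (simp add: matrix_vector_mul_assoc)
      also have "G ** (mat 1 - G) = 0"
        using G by (simp add: grassmannian_def matrix_mult_algebra)
      finally show ?thesis by simp
    qed
    then show ?thesis
      by (simp add: vec_eq_iff matrix_matrix_mult_def matrix_vector_mult_def V_def)
  qed
  ultimately show ?thesis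
    using that frame_projection_eqI[OF _ G] by blast
qed

text \<open>\<open>Q\<close> acts as \<open>V E\<^sup>T\<close> on the range of \<open>E\<close>, and on its orthogonal complement as a linear isometry onto the
  complement of the range of \<open>V\<close>, which exists because the complements have equal dimension.\<close>

lemma orthogonal_matrix_mapping_frames:
  fixes E V :: "real^'r^'n"
  assumes E: "E \<in> stiefel" and V: "V \<in> stiefel"
  obtains Q :: "real^'n^'n" where "orthogonal_matrix Q" and "Q ** E = V"
proof -
  let ?P = "\<lambda>W :: real^'r^'n. mat 1 - W ** transpose W"
  have EE: "transpose E ** E = mat 1" and VV: "transpose V ** V = mat 1"
    using E V by (simp_all add: stiefel_def)
  have sub: "subspace (range ((*v) M))" for M :: "real^'n^'n"
    by (auto intro: linear_subspace_image matrix_vector_mul_linear)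
  have dim_eq: "dim (range ((*v) (?P E))) = dim (range ((*v) (?P V)))"
    using frame_complement_in_grassmannian[OF E] frame_complement_in_grassmannian[OF V]
    by (simp add: grassmannian_def flip: rank_dim_range)
  obtain f :: "real^'n \<Rightarrow> real^'n" where f: "linear f"
      "f ` range ((*v) (?P E)) = range ((*v) (?P V))"
      "\<And>x. x \<in> range ((*v) (?P E)) \<Longrightarrow> norm (f x) = norm x"
    by (rule isometries_subspaces[OF sub sub dim_eq]) (rule that; assumption)
  define Q where "Q = V ** transpose E + matrix f ** ?P E"
  have Qx: "Q *v x = V *v (transpose E *v x) + f (?P E *v x)" for x
    by (simp add: Q_def matrix_vector_mult_add_rdistrib matrix_works f(1) linear_matrix_vector_mul_eq
        del: transpose_matrix_vector flip: matrix_vector_mul_assoc)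
  have frame_norm: "norm (W *v z) = norm z" if "transpose W ** W = mat 1"
    for W :: "real^'r^'n" and z
  proof -
    have "(W *v z) \<bullet> (W *v z) = z \<bullet> ((transpose W ** W) *v z)"
      by (metis dot_lmul_matrix matrix_vector_mul_assoc vector_transpose_matrix transpose_transpose)
    then show ?thesis by (simp add: that norm_eq_sqrt_inner)
  qed
  have frame_orth: "(W *v z) \<bullet> (?P W *v y) = 0" if "transpose W ** W = mat 1"
    for W :: "real^'r^'n" and z y
  proof -
    have "(W *v z) \<bullet> (?P W *v y) = z \<bullet> ((transpose W ** ?P W) *v y)"
      by (metis dot_lmul_matrix matrix_vector_mul_assoc vector_transpose_matrix transpose_transpose)
    also have "transpose W ** ?P W = 0"
      by (simp add: matrix_mult_algebra matrix_mul_assoc that)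
    finally show ?thesis by simp
  qed
  have "norm (Q *v x) = norm x" for x
  proof -
    let ?z = "transpose E *v x"
    obtain y where y: "f (?P E *v x) = ?P V *v y"
      using f(2) by blast
    have "(norm (Q *v x))\<^sup>2 = (norm (V *v ?z))\<^sup>2 + (norm (f (?P E *v x)))\<^sup>2"
      unfolding Qx by (rule norm_add_Pythagorean) (simp only: y orthogonal_def frame_orth[OF VV])
    also have "\<dots> = (norm (E *v ?z))\<^sup>2 + (norm (?P E *v x))\<^sup>2"
      using f(3) by (simp only: frame_norm[OF VV] frame_norm[OF EE]) auto
    also have "\<dots> = (norm (E *v ?z + ?P E *v x))\<^sup>2"
      by (rule norm_add_Pythagorean[symmetric]) (simp only: orthogonal_def frame_orth[OF EE])
    also have "E *v ?z + ?P E *v x = x"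
      by (simp only: matrix_vector_mul_assoc flip: matrix_vector_mult_add_rdistrib) simp
    finally show ?thesis by simp
  qed
  then have "orthogonal_transformation ((*v) Q)"
    by (simp add: orthogonal_transformation)
  then have "orthogonal_matrix Q"
    by (simp add: orthogonal_transformation_matrix)
  moreover have "Q ** E = V"
  proof -
    have "?P E ** E = 0"
      by (simp add: matrix_mult_algebra EE flip: matrix_mul_assoc)
    then show ?thesis
      by (simp add: Q_def matrix_mult_algebra EE flip: matrix_mul_assoc)
  qed
  ultimately show ?thesis by (rule that)
qed

text \<open>Padding with zero columns is itself a product with the transpose of a frame: the columns of \<open>E\<close> are
  the coordinate vectors selected by \<open>\<iota>\<close>.\<close>

lemma pad_columns_frame:
  fixes \<iota> :: "'r::finite \<Rightarrow> 'n::finite"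
  assumes "inj \<iota>"
  obtains E :: "real^'r^'n" where "E \<in> stiefel"
    and "\<And>H :: real^'r^'m. pad_columns \<iota> H = H ** transpose E"
proof
  define E :: "real^'r^'n" where "E = (\<chi> i j. if i = \<iota> j then 1 else 0)"
  show "E \<in> stiefel"
    using assms
    by (auto simp: stiefel_def E_def matrix_matrix_mult_def transpose_def mat_def vec_eq_iff
        inj_def if_distrib[of "\<lambda>x. x * _"] cong: if_cong)
  show "pad_columns \<iota> H = H ** transpose E" for H :: "real^'r^'m"
  proof -
    have "(\<Sum>k\<in>UNIV. H $ i $ k * (if j = \<iota> k then 1 else 0)) =
        (if j \<in> range \<iota> then H $ i $ inv \<iota> j else 0)" for i j
    proof (cases "j \<in> range \<iota>")
      case True
      then obtain l where l: "j = \<iota> l" by auto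
      have "(\<Sum>k\<in>UNIV. H $ i $ k * (if j = \<iota> k then 1 else 0)) =
          (\<Sum>k\<in>UNIV. if k = l then H $ i $ k else 0)"
        using assms by (intro sum.cong) (auto simp: l inj_def)
      then show ?thesis using assms by (simp add: l)
    qed (auto intro!: sum.neutral)
    then show ?thesis
      by (simp add: pad_columns_def E_def matrix_matrix_mult_def transpose_def vec_eq_iff)
  qed
qed

text \<open>Since an orthogonal matrix carries any frame to any other, the invariant function \<open>h\<close> cannot
  distinguish \<open>H V\<^sup>T\<close> from \<open>[H 0]\<close>.\<close>

lemma invariant_pad_columns:
  fixes h :: "real^'n^'m \<Rightarrow> 'b" and H :: "real^'r^'m" and V :: "real^'r^'n"
  assumes "inj \<iota>" and "orthogonally_invariant h" and "V \<in> stiefel"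
  shows "h (H ** transpose V) = h (pad_columns \<iota> H)"
proof -
  obtain E :: "real^'r^'n" where E: "E \<in> stiefel" "pad_columns \<iota> H = H ** transpose E"
    using pad_columns_frame[OF assms(1)] by metis
  obtain Q where Q: "orthogonal_matrix Q" "Q ** E = V"
    using orthogonal_matrix_mapping_frames[OF E(1) assms(3)] .
  have "H ** transpose V = pad_columns \<iota> H ** transpose Q"
    by (simp add: E(2) Q(2)[symmetric] matrix_transpose_mul matrix_mul_assoc)
  moreover have "orthogonal_matrix (transpose Q)"
    using Q(1) by (simp add: orthogonal_matrix_def)
  ultimately show ?thesis
    using assms(2) by (simp add: orthogonally_invariant_def)
qed

section \<open>Tangent spaces by curves\<close>

lemma tangent_space_curveI:
  assumes "smooth_on_open T \<gamma>" and "(0::real) \<in> T" and "\<gamma> ` T \<subseteq> M"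
    and "\<gamma> 0 = x" and "(\<gamma> has_vector_derivative v) (at 0)"
  shows "v \<in> tangent_space M x"
proof -
  obtain \<epsilon> where \<epsilon>: "\<epsilon> > 0" "ball 0 \<epsilon> \<subseteq> T"
    using smooth_on_open_open[OF assms(1)] assms(2) open_contains_ball by blast
  then have sub: "{-\<epsilon><..<\<epsilon>} \<subseteq> T"
    by (simp add: ball_eq_greaterThanLessThan)
  have "smooth_on_open {-\<epsilon><..<\<epsilon>} \<gamma>"
    by (rule smooth_subset[OF assms(1) _ sub]) simp
  moreover have "\<gamma> ` {-\<epsilon><..<\<epsilon>} \<subseteq> M"
    using sub assms(3) by blast
  ultimately show ?thesis
    unfolding tangent_space_def using \<epsilon>(1) assms(4,5) by blast
qed

lemma tangent_space_scaleR:
  assumes "v \<in> tangent_space M x"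
  shows "c *\<^sub>R v \<in> tangent_space M x"
proof -
  obtain \<gamma> and \<epsilon> :: real where \<gamma>: "\<epsilon> > 0" "smooth_on_open {-\<epsilon><..<\<epsilon>} \<gamma>"
      "\<gamma> ` {-\<epsilon><..<\<epsilon>} \<subseteq> M" "\<gamma> 0 = x" "(\<gamma> has_vector_derivative v) (at 0)"
    using assms unfolding tangent_space_def by blast
  have lin: "smooth_on_open UNIV ((*) c)"
    by (intro smooth_bilinear[OF bounded_bilinear_mult] smooth_const smooth_ident open_UNIV)
  let ?T = "UNIV \<inter> (*) c -` {-\<epsilon><..<\<epsilon>}"
  have T: "open ?T"
    by (rule open_smooth_preimage[OF lin]) simp
  show ?thesis
  proof (rule tangent_space_curveI)
    show "smooth_on_open ?T (\<lambda>t. \<gamma> (c * t))"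
      by (rule smooth_compose[OF \<gamma>(2) smooth_subset[OF lin T]]) auto
    have "((*) c has_vector_derivative c) (at 0)"
      by (auto intro!: derivative_eq_intros)
    from vector_diff_chain_at[OF this] \<gamma>(5)
    show "((\<lambda>t. \<gamma> (c * t)) has_vector_derivative c *\<^sub>R v) (at 0)"
      by (simp add: o_def)
  qed (use \<gamma> in auto)
qed

lemma has_vector_derivative_at_eqI:
  assumes "(f has_vector_derivative a) (at t)" and "(g has_vector_derivative b) (at t)"
    and "open T" and "t \<in> T" and "\<And>s. s \<in> T \<Longrightarrow> f s = g s"
  shows "a = b"
proof -
  have "(g has_vector_derivative a) (at t)"
    using has_vector_derivative_transform_within_open[OF assms(1,3,4,5)] .
  then show ?thesis
    using assms(2) by (rule vector_derivative_unique_at)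
qed

lemma has_vector_derivative_has_derivative_compose:
  assumes "(f has_vector_derivative v) (at t)" and "(N has_derivative N') (at (f t))"
  shows "((\<lambda>t. N (f t)) has_vector_derivative N' v) (at t)"
  using vector_derivative_diff_chain_within[OF assms(1) has_derivative_at_withinI[OF assms(2)]]
  by (simp add: o_def)

lemmas has_vector_derivative_matrix_mult =
  bounded_bilinear.has_vector_derivative[OF bounded_bilinear_matrix_mult]

lemmas has_vector_derivative_transpose =
  bounded_linear.has_vector_derivative[OF bounded_linear_transpose]

text \<open>The velocity is attained by the orthonormalized line \<open>N (V + t w)\<close>. Hence
  the pair \<open>(V, V\<^sub>p)\<close> of every representation lies in the tangent bundle, where \<open>RSt\<close> is controlled.\<close>

lemma tangent_space_stiefelI:
  fixes V w :: "real^'r^'n"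
  assumes V: "V \<in> stiefel" and w: "transpose V ** w = 0"
  shows "w \<in> tangent_space stiefel V"
proof -
  obtain U and N :: "real^'r^'n \<Rightarrow> real^'r^'n"
    where N: "smooth_on_open U N" "stiefel \<subseteq> U" "\<And>W. W \<in> U \<Longrightarrow> N W \<in> stiefel" "N V = V"
      "frechet_derivative N (at V) w = w"
    using smooth_orthonormalization V w by metis
  have VU: "V \<in> U"
    using N(2) V by blast
  define l where "l = (\<lambda>t::real. V + t *\<^sub>R w)"
  have l: "smooth_on_open UNIV l"
    unfolding l_def
    by (intro smooth_add smooth_bilinear[OF bounded_bilinear_scaleR] smooth_const smooth_ident
        open_UNIV)
  have T: "open (UNIV \<inter> l -` U)"
    by (rule open_smooth_preimage[OF l smooth_on_open_open[OF N(1)]])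
  show ?thesis
  proof (rule tangent_space_curveI)
    show "smooth_on_open (UNIV \<inter> l -` U) (\<lambda>t. N (l t))"
      by (rule smooth_compose[OF N(1) smooth_subset[OF l T]]) auto
    have "(l has_vector_derivative w) (at 0)"
      unfolding l_def by (auto intro!: derivative_eq_intros)
    moreover have "(N has_derivative frechet_derivative N (at V)) (at (l 0))"
      using smooth_imp_has_derivative[OF N(1) VU] by (simp add: l_def)
    ultimately show "((\<lambda>t. N (l t)) has_vector_derivative w) (at 0)"
      using has_vector_derivative_has_derivative_compose N(5) by fastforce
  qed (use N(3,4) VU in \<open>auto simp: l_def\<close>)
qed

section \<open>Representations of tangent vectors\<close>

text \<open>Every frame of \<open>G\<close>, not just one chosen frame, gives a representation. This freedom is used for
  smoothness, where the frame varies with \<open>G\<close>.\<close>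

lemma frame_represents:
  fixes h :: "real^'n^'m \<Rightarrow> real^'q" and \<iota> :: "'r::finite \<Rightarrow> 'n::finite"
    and V :: "real^'r^'n"
  assumes "inj \<iota>" and "orthogonally_invariant h"
    and tangent: "((X, G), (\<eta>, \<zeta>)) \<in> tangent_bundle (Mh CARD('r) h)"
    and V: "V \<in> stiefel" and GV: "mat 1 - G = V ** transpose V"
  shows "represents_point \<iota> h (X ** V) V X G"
    and "represents_tangent \<iota> h (X ** V) V (\<eta> ** V) (- (\<zeta> ** V)) \<eta> \<zeta>"
proof -
  have VV: "transpose V ** V = mat 1"
    using V by (simp add: stiefel_def)
  \<comment> \<open>Used at the given point with the frame \<open>V\<close>, and along a curve with a moving frame.\<close>
  have Hr: "Y ** W \<in> Hr \<iota> h \<and> mat 1 - F = W ** transpose W \<and> Y = Y ** W ** transpose W"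
    if "(Y, F) \<in> Mh CARD('r) h" "W \<in> stiefel" "F ** W = 0" for Y F and W :: "real^'r^'n"
  proof -
    have F: "F \<in> grassmannian (CARD('n) - CARD('r))" "Y ** F = 0" "h Y = 0"
      using that(1) by (auto simp: Mh_def)
    have P: "mat 1 - F = W ** transpose W"
      by (rule frame_projection_eqI[OF that(2) F(1) that(3)])
    have "Y = Y ** (mat 1 - F)"
      by (simp add: matrix_mult_algebra F(2))
    then have "Y = Y ** W ** transpose W"
      by (simp add: P matrix_mul_assoc)
    moreover from this have "Y ** W \<in> Hr \<iota> h"
      using invariant_pad_columns[OF assms(1,2) that(2), of "Y ** W"] F(3) by (simp add: Hr_def)
    ultimately show ?thesis using P by simp
  qed
  have "(mat 1 - G) ** V = V"
    by (simp add: GV VV flip: matrix_mul_assoc)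
  then have GV0: "G ** V = 0"
    by (simp add: matrix_mult_algebra)
  obtain \<gamma> and \<epsilon> :: real where \<gamma>: "\<epsilon> > 0" "smooth_on_open {-\<epsilon><..<\<epsilon>} \<gamma>"
      "\<gamma> ` {-\<epsilon><..<\<epsilon>} \<subseteq> Mh CARD('r) h" "\<gamma> 0 = (X, G)"
      "(\<gamma> has_vector_derivative (\<eta>, \<zeta>)) (at 0)"
    using tangent unfolding tangent_bundle_def tangent_space_def by blast
  define x where "x = (\<lambda>t. fst (\<gamma> t))"
  define g where "g = (\<lambda>t. snd (\<gamma> t))"
  have x0: "x 0 = X" and g0: "g 0 = G"
    by (simp_all add: x_def g_def \<gamma>(4))
  have dx: "(x has_vector_derivative \<eta>) (at 0)" and dg: "(g has_vector_derivative \<zeta>) (at 0)"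
    using bounded_linear.has_vector_derivative[OF bounded_linear_fst \<gamma>(5)]
      bounded_linear.has_vector_derivative[OF bounded_linear_snd \<gamma>(5)]
    by (simp_all add: x_def g_def)
  let ?I = "{-\<epsilon><..<\<epsilon>}"
  have M: "(x t, g t) \<in> Mh CARD('r) h" if "t \<in> ?I" for t
    using \<gamma>(3) that by (auto simp: x_def g_def)
  have eqs: "transpose (g t) = g t" "g t ** g t = g t" "x t ** g t = 0" if "t \<in> ?I" for t
    using M[OF that] by (auto simp: Mh_def grassmannian_def)
  have I: "open ?I" "0 \<in> ?I"
    using \<gamma>(1) by auto
  have sym: "transpose \<zeta> = \<zeta>"
    by (rule has_vector_derivative_at_eqI[OF has_vector_derivative_transpose[OF dg] dg I eqs(1)])
  have idem: "G ** \<zeta> + \<zeta> ** G = \<zeta>"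
    using has_vector_derivative_at_eqI[OF has_vector_derivative_matrix_mult[OF dg dg] dg I eqs(2)]
    by (simp add: g0)
  have XG: "X ** \<zeta> + \<eta> ** G = 0"
    using has_vector_derivative_at_eqI[OF has_vector_derivative_matrix_mult[OF dx dg]
        has_vector_derivative_const I eqs(3)]
    by (simp add: x0 g0)
  have M0: "(X, G) \<in> Mh CARD('r) h"
    using M[OF I(2)] by (simp add: x0 g0)
  note Hr0 = Hr[OF M0 V GV0]
  then show "represents_point \<iota> h (X ** V) V X G"
    using V by (simp add: represents_point_def GV[symmetric])
  have G_sym: "transpose G = G"
    using eqs(1)[OF I(2)] by (simp add: g0)
  have orth: "transpose V ** (- (\<zeta> ** V)) = 0"
  proof -
    have VG: "transpose V ** G = 0"
      using arg_cong[OF GV0, of transpose] G_sym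
      by (simp add: matrix_transpose_mul transpose_algebra)
    have "transpose V ** (G ** \<zeta> + \<zeta> ** G) ** V
        = transpose V ** G ** \<zeta> ** V + transpose V ** \<zeta> ** (G ** V)"
      by (simp add: matrix_mult_algebra matrix_mul_assoc)
    then show ?thesis
      by (simp add: idem VG GV0 matrix_mult_algebra matrix_mul_assoc)
  qed
  have X\<zeta>V: "X ** \<zeta> ** V = 0"
  proof -
    have "(X ** \<zeta> + \<eta> ** G) ** V = X ** \<zeta> ** V + \<eta> ** (G ** V)"
      by (simp add: matrix_mult_algebra matrix_mul_assoc)
    then show ?thesis by (simp add: XG GV0 matrix_mult_algebra)
  qed
  have \<eta>: "\<eta> = \<eta> ** V ** transpose V + X ** V ** transpose (- (\<zeta> ** V))"
  proof -
    have "\<eta> ** V ** transpose V + X ** V ** transpose (- (\<zeta> ** V))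
        = \<eta> ** (mat 1 - G) - X ** (mat 1 - G) ** \<zeta>"
      by (simp add: GV transpose_algebra matrix_transpose_mul sym matrix_mult_algebra
          matrix_mul_assoc)
    also have "\<dots> = \<eta> - (X ** \<zeta> + \<eta> ** G)"
      using M0 by (simp add: matrix_mult_algebra Mh_def)
    finally show ?thesis by (simp add: XG)
  qed
  have \<zeta>: "\<zeta> = - (- (\<zeta> ** V) ** transpose V) - V ** transpose (- (\<zeta> ** V))"
  proof -
    have "- (- (\<zeta> ** V) ** transpose V) - V ** transpose (- (\<zeta> ** V))
        = \<zeta> ** (mat 1 - G) + (mat 1 - G) ** \<zeta>"
      by (simp add: GV transpose_algebra matrix_transpose_mul sym matrix_mult_algebra
          matrix_mul_assoc)
    also have "\<dots> = \<zeta> + (\<zeta> - (G ** \<zeta> + \<zeta> ** G))"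
      by (simp add: matrix_mult_algebra)
    finally show ?thesis by (simp add: idem)
  qed
  have "\<eta> ** V \<in> tangent_space (Hr \<iota> h) (X ** V)"
  proof -
    obtain U and N :: "real^'r^'n \<Rightarrow> real^'r^'n"
      where N: "smooth_on_open U N" "stiefel \<subseteq> U" "\<And>W. W \<in> U \<Longrightarrow> N W \<in> stiefel"
        "\<And>W. W \<in> U \<Longrightarrow> \<exists>C. N W = W ** C" "N V = V"
        "frechet_derivative N (at V) (- (\<zeta> ** V)) = - (\<zeta> ** V)"
      using smooth_orthonormalization V orth by metis
    have VU: "V \<in> U"
      using N(2) V by blast
    \<comment> \<open>The projected frame \<open>w\<close> has velocity \<open>- \<zeta> V\<close>, which \<open>N\<close> preserves by \<open>orth\<close>; so
      \<open>x(t) N (w(t))\<close> has velocity \<open>\<eta> V - X \<zeta> V = \<eta> V\<close>.\<close>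
    define w where "w = (\<lambda>t. (mat 1 - g t) ** V)"
    have w0: "w 0 = V"
      by (simp add: w_def g0 GV VV flip: matrix_mul_assoc)
    have "smooth_on_open ?I g" and x: "smooth_on_open ?I x"
      unfolding g_def x_def by (intro smooth_snd smooth_fst \<gamma>(2))+
    then have w: "smooth_on_open ?I w"
      unfolding w_def by (intro smooth_matrix_mult smooth_diff smooth_const I(1))
    let ?T = "?I \<inter> w -` U"
    have T: "open ?T"
      by (rule open_smooth_preimage[OF w smooth_on_open_open[OF N(1)]])
    have dw: "(w has_vector_derivative - (\<zeta> ** V)) (at 0)"
      using has_vector_derivative_matrix_mult[OF has_vector_derivative_diff[OF
            has_vector_derivative_const[of "mat 1"] dg] has_vector_derivative_const[of V]]
      unfolding w_def by (simp add: matrix_mult_algebra)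
    have "(N has_derivative frechet_derivative N (at V)) (at (w 0))"
      using smooth_imp_has_derivative[OF N(1) VU] by (simp add: w0)
    with dw have dN: "((\<lambda>t. N (w t)) has_vector_derivative - (\<zeta> ** V)) (at 0)"
      using has_vector_derivative_has_derivative_compose N(6) by fastforce
    show ?thesis
    proof (rule tangent_space_curveI)
      show "smooth_on_open ?T (\<lambda>t. x t ** N (w t))"
        by (intro smooth_matrix_mult smooth_subset[OF x T] smooth_compose[OF N(1)]
            smooth_subset[OF w T]) auto
      show "((\<lambda>t. x t ** N (w t)) has_vector_derivative \<eta> ** V) (at 0)"
        using has_vector_derivative_matrix_mult[OF dx dN]
        by (simp add: x0 w0 N(5) matrix_mult_algebra matrix_mul_assoc X\<zeta>V)
      show "(\<lambda>t. x t ** N (w t)) ` ?T \<subseteq> Hr \<iota> h"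
      proof clarify
        fix t assume t: "t \<in> ?I" "w t \<in> U"
        obtain C where "N (w t) = w t ** C"
          using N(4)[OF t(2)] by blast
        moreover have "g t ** w t = 0"
          by (simp add: w_def matrix_mul_assoc) (simp add: matrix_mult_algebra eqs(2)[OF t(1)])
        ultimately have "g t ** N (w t) = 0"
          by (simp add: matrix_mul_assoc matrix_mult_algebra)
        then show "x t ** N (w t) \<in> Hr \<iota> h"
          using Hr[OF M[OF t(1)] N(3)[OF t(2)]] by simp
      qed
    qed (use I(2) VU in \<open>auto simp: w0 x0 N(5)\<close>)
  qed
  with orth \<eta> \<zeta> show "represents_tangent \<iota> h (X ** V) V (\<eta> ** V) (- (\<zeta> ** V)) \<eta> \<zeta>"
    by (simp add: represents_tangent_def)
qed

text \<open>The representing data are determined by the tangent vector and the frame. In particular they depend smoothly on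
  \<open>X, \<eta>, \<zeta>\<close> and the frame, and equivariantly on the frame.\<close>

lemma represents_tangent_solve:
  assumes "represents_point \<iota> h H V X G" and "represents_tangent \<iota> h H V K Vp \<eta> \<zeta>"
  shows "H = X ** V" and "K = \<eta> ** V" and "Vp = - (\<zeta> ** V)"
proof -
  have VV: "transpose V ** V = mat 1" and X: "X = H ** transpose V"
    using assms(1) by (simp_all add: represents_point_def stiefel_def)
  have 0: "transpose V ** Vp = 0" and \<eta>: "\<eta> = K ** transpose V + H ** transpose Vp"
    and \<zeta>: "\<zeta> = - (Vp ** transpose V) - V ** transpose Vp"
    using assms(2) by (simp_all add: represents_tangent_def)
  have 1: "transpose Vp ** V = 0"
    using arg_cong[OF 0, of transpose] by (simp add: matrix_transpose_mul transpose_algebra)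
  show "H = X ** V"
    by (simp add: X VV flip: matrix_mul_assoc)
  show "K = \<eta> ** V"
    by (simp add: \<eta> matrix_mult_algebra VV 1 flip: matrix_mul_assoc)
  show "Vp = - (\<zeta> ** V)"
    by (simp add: \<zeta> matrix_mult_algebra VV 1 flip: matrix_mul_assoc)
qed

lemma represents_in_tangent_bundles:
  assumes "represents_point \<iota> h H V X G" and "represents_tangent \<iota> h H V K Vp \<eta> \<zeta>"
  shows "(H, K) \<in> tangent_bundle (Hr \<iota> h)" and "(V, Vp) \<in> tangent_bundle stiefel"
  using assms tangent_space_stiefelI
  by (auto simp: represents_point_def represents_tangent_def tangent_bundle_def)

lemma orthogonally_homogeneousD:
  assumes "orthogonally_homogeneous M R" and "orthogonal_matrix Q" and "(X, \<xi>) \<in> tangent_bundle M"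
  shows "R (X ** Q, \<xi> ** Q) = R (X, \<xi>) ** Q"
  using assms unfolding orthogonally_homogeneous_def by fastforce

section \<open>The lifted map\<close>

text \<open>The frames \<open>V\<close> and \<open>V'\<close> have the same projection, so \<open>V' = V Q\<close> with \<open>Q = V\<^sup>T V'\<close> orthogonal. The
  remaining data are multiples of the frames and pick up the same factor, which homogeneity carries to
  the retracted matrices, where it cancels.\<close>

lemma lifted_value_unique:
  fixes RSt :: "(real^'r^'n) \<times> (real^'r^'n) \<Rightarrow> real^'r^'n"
    and RH :: "(real^'r^'m) \<times> (real^'r^'m) \<Rightarrow> real^'r^'m"
  assumes hom: "orthogonally_homogeneous stiefel RSt" "orthogonally_homogeneous (Hr \<iota> h) RH"
    and "lifted_value \<iota> h RH RSt x Y" and "lifted_value \<iota> h RH RSt x Y'"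
  shows "Y = Y'"
proof -
  obtain X G \<eta> \<zeta> where x: "x = ((X, G), (\<eta>, \<zeta>))"
    by (metis surj_pair)
  obtain H V K Vp where 1: "represents_point \<iota> h H V X G"
      "represents_tangent \<iota> h H V K Vp \<eta> \<zeta>"
      "Y = (RH (H, K) ** transpose (RSt (V, Vp)), mat 1 - RSt (V, Vp) ** transpose (RSt (V, Vp)))"
    using assms(3) by (auto simp: x lifted_value_def)
  obtain H' V' K' Vp' where 2: "represents_point \<iota> h H' V' X G"
      "represents_tangent \<iota> h H' V' K' Vp' \<eta> \<zeta>"
      "Y' = (RH (H', K') ** transpose (RSt (V', Vp')),
        mat 1 - RSt (V', Vp') ** transpose (RSt (V', Vp')))"
    using assms(4) by (auto simp: x lifted_value_def)
  define Q where "Q = transpose V ** V'"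
  have V: "transpose V ** V = mat 1" and V': "transpose V' ** V' = mat 1"
    and G: "G = mat 1 - V ** transpose V" "G = mat 1 - V' ** transpose V'"
    using 1(1) 2(1) by (simp_all add: represents_point_def stiefel_def)
  have VV: "V ** transpose V = V' ** transpose V'"
    using G by simp
  have VQ: "V' = V ** Q"
    by (simp add: Q_def matrix_mul_assoc VV) (simp add: V' flip: matrix_mul_assoc)
  have "transpose Q ** Q = transpose V' ** (V ** transpose V) ** V'"
    by (simp add: Q_def matrix_transpose_mul matrix_mul_assoc)
  also have "\<dots> = (transpose V' ** V') ** (transpose V' ** V')"
    by (simp only: VV matrix_mul_assoc)
  finally have Q: "orthogonal_matrix Q"
    by (simp add: orthogonal_matrix V')
  then have QQ: "Q ** transpose Q = mat 1"
    by (simp add: orthogonal_matrix_def)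
  note s1 = represents_tangent_solve[OF 1(1,2)] and s2 = represents_tangent_solve[OF 2(1,2)]
  have H: "H' = H ** Q" "K' = K ** Q" "Vp' = Vp ** Q"
    unfolding s1 s2 VQ by (simp_all add: matrix_mul_assoc matrix_mult_algebra)
  have RH: "RH (H', K') = RH (H, K) ** Q"
    unfolding H
    by (rule orthogonally_homogeneousD[OF hom(2) Q represents_in_tangent_bundles(1)[OF 1(1,2)]])
  have RSt: "RSt (V', Vp') = RSt (V, Vp) ** Q"
    unfolding H VQ
    by (rule orthogonally_homogeneousD[OF hom(1) Q represents_in_tangent_bundles(2)[OF 1(1,2)]])
  have cancel: "A ** Q ** transpose (B ** Q) = A ** transpose B"
    for A :: "real^'r^'k" and B :: "real^'r^'l"
    by (simp add: matrix_transpose_mul matrix_mul_assoc)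
       (simp add: QQ flip: matrix_mul_assoc)
  show ?thesis
    by (simp add: 1(3) 2(3) RH RSt cancel)
qed

lemma lifted_valueI:
  assumes "represents_point \<iota> h H V X G" and "represents_tangent \<iota> h H V K Vp \<eta> \<zeta>"
  shows "lifted_value \<iota> h RH RSt ((X, G), (\<eta>, \<zeta>))
    (RH (H, K) ** transpose (RSt (V, Vp)), mat 1 - RSt (V, Vp) ** transpose (RSt (V, Vp)))"
  unfolding lifted_value_def prod.case using assms by blast

lemma lifted_map_eqI:
  fixes RSt :: "(real^'r^'n) \<times> (real^'r^'n) \<Rightarrow> real^'r^'n"
    and RH :: "(real^'r^'m) \<times> (real^'r^'m) \<Rightarrow> real^'r^'m"
  assumes "orthogonally_homogeneous stiefel RSt" and "orthogonally_homogeneous (Hr \<iota> h) RH"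
    and "represents_point \<iota> h H V X G" and "represents_tangent \<iota> h H V K Vp \<eta> \<zeta>"
  shows "lifted_map \<iota> h RH RSt ((X, G), (\<eta>, \<zeta>)) =
    (RH (H, K) ** transpose (RSt (V, Vp)), mat 1 - RSt (V, Vp) ** transpose (RSt (V, Vp)))"
  unfolding lifted_map_def
proof (rule the_equality)
  show lifted: "lifted_value \<iota> h RH RSt ((X, G), (\<eta>, \<zeta>))
      (RH (H, K) ** transpose (RSt (V, Vp)), mat 1 - RSt (V, Vp) ** transpose (RSt (V, Vp)))"
    by (rule lifted_valueI[OF assms(3,4)])
  show "Y = (RH (H, K) ** transpose (RSt (V, Vp)),
      mat 1 - RSt (V, Vp) ** transpose (RSt (V, Vp)))"
    if "lifted_value \<iota> h RH RSt ((X, G), (\<eta>, \<zeta>)) Y" for Y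
    by (rule lifted_value_unique[OF assms(1,2) that lifted])
qed

lemma frame_product_in_Mh:
  fixes h :: "real^'n^'m \<Rightarrow> real^'q" and \<iota> :: "'r::finite \<Rightarrow> 'n::finite"
    and V :: "real^'r^'n"
  assumes "inj \<iota>" and "orthogonally_invariant h" and "H \<in> Hr \<iota> h" and V: "V \<in> stiefel"
  shows "(H ** transpose V, mat 1 - V ** transpose V) \<in> Mh CARD('r) h"
proof -
  have VV: "transpose V ** V = mat 1"
    using V by (simp add: stiefel_def)
  have "H ** transpose V ** (mat 1 - V ** transpose V)
      = H ** transpose V - H ** (transpose V ** V) ** transpose V"
    by (simp add: matrix_mult_algebra matrix_mul_assoc)
  then have "H ** transpose V ** (mat 1 - V ** transpose V) = 0"
    by (simp add: VV)
  then show ?thesis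
    using frame_complement_in_grassmannian[OF V] assms(3) invariant_pad_columns[OF assms(1,2) V]
    by (simp add: Mh_def Hr_def)
qed

lemma tangent_vector_represented:
  fixes h :: "real^'n^'m \<Rightarrow> real^'q" and \<iota> :: "'r::finite \<Rightarrow> 'n::finite"
  assumes "CARD('r) \<le> CARD('n)" and "inj \<iota>" and "orthogonally_invariant h"
    and "((X, G), (\<eta>, \<zeta>)) \<in> tangent_bundle (Mh CARD('r) h)"
  obtains H :: "real^'r^'m" and V :: "real^'r^'n" and K Vp
  where "represents_point \<iota> h H V X G" and "represents_tangent \<iota> h H V K Vp \<eta> \<zeta>"
proof -
  have "G \<in> grassmannian (CARD('n) - CARD('r))"
    using assms(4) by (auto simp: tangent_bundle_def Mh_def)
  then obtain V :: "real^'r^'n" where V: "V \<in> stiefel" "mat 1 - G = V ** transpose V"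
    using frame_exists[OF _ assms(1)] by metis
  show ?thesis
    by (rule that[OF frame_represents[OF assms(2-4) V]])
qed

text \<open>Near a given tangent vector the frame \<open>N ((I - G) V\<^sub>0)\<close> depends smoothly on \<open>G\<close>, and with it the
  representing data \<open>a\<close> and \<open>b\<close>, as functions on an open set of the ambient space. Local smooth
  extensions of \<open>RH\<close> and \<open>RSt\<close> are then composed with \<open>a\<close> and \<open>b\<close>; on the tangent bundle the
  result is the lifted map, since the value may be computed with any frame.\<close>

lemma smooth_lifted_map:
  fixes h :: "real^'n^'m \<Rightarrow> real^'q" and \<iota> :: "'r::finite \<Rightarrow> 'n::finite"
    and RSt :: "(real^'r^'n) \<times> (real^'r^'n) \<Rightarrow> real^'r^'n"
    and RH :: "(real^'r^'m) \<times> (real^'r^'m) \<Rightarrow> real^'r^'m"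
  assumes le: "CARD('r) \<le> CARD('n)" and \<iota>: "inj \<iota>" and inv: "orthogonally_invariant h"
    and RSt: "smooth_map_on (tangent_bundle stiefel) RSt" "orthogonally_homogeneous stiefel RSt"
    and RH: "smooth_map_on (tangent_bundle (Hr \<iota> h)) RH" "orthogonally_homogeneous (Hr \<iota> h) RH"
  shows "smooth_map_on (tangent_bundle (Mh CARD('r) h)) (lifted_map \<iota> h RH RSt)"
  unfolding smooth_map_on_def
proof
  fix p0 assume p0: "p0 \<in> tangent_bundle (Mh CARD('r) h)"
  obtain X0 G0 \<eta>0 \<zeta>0 where p0_eq: "p0 = ((X0, G0), (\<eta>0, \<zeta>0))"
    by (metis surj_pair)
  obtain H0 :: "real^'r^'m" and V0 :: "real^'r^'n" and K0 Vp0
    where rep0: "represents_point \<iota> h H0 V0 X0 G0" "represents_tangent \<iota> h H0 V0 K0 Vp0 \<eta>0 \<zeta>0"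
    using tangent_vector_represented[OF le \<iota> inv] p0 unfolding p0_eq by metis
  have V0: "V0 \<in> stiefel" and G0: "G0 = mat 1 - V0 ** transpose V0"
    using rep0(1) by (simp_all add: represents_point_def)
  obtain U and N :: "real^'r^'n \<Rightarrow> real^'r^'n"
    where N: "smooth_on_open U N" "stiefel \<subseteq> U" "\<And>W. W \<in> U \<Longrightarrow> N W \<in> stiefel"
      "\<And>W. W \<in> U \<Longrightarrow> \<exists>C. N W = W ** C" "N V0 = V0"
    using smooth_orthonormalization V0 by metis
  obtain UH gH where gH: "(H0, K0) \<in> UH" "smooth_on_open UH gH"
      "\<And>y. y \<in> tangent_bundle (Hr \<iota> h) \<inter> UH \<Longrightarrow> RH y = gH y"
    using RH(1) represents_in_tangent_bundles(1)[OF rep0] unfolding smooth_map_on_def by meson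
  obtain US gS where gS: "(V0, Vp0) \<in> US" "smooth_on_open US gS"
      "\<And>y. y \<in> tangent_bundle stiefel \<inter> US \<Longrightarrow> RSt y = gS y"
    using RSt(1) represents_in_tangent_bundles(2)[OF rep0] unfolding smooth_map_on_def by meson
  define W where "W = (\<lambda>p :: ((real^'n^'m) \<times> (real^'n^'n)) \<times> ((real^'n^'m) \<times> (real^'n^'n)).
    (mat 1 - snd (fst p)) ** V0)"
  define frame where "frame = (\<lambda>p. N (W p))"
  define a where "a = (\<lambda>p. (fst (fst p) ** frame p, fst (snd p) ** frame p))"
  define b where "b = (\<lambda>p. (frame p, - (snd (snd p) ** frame p)))"
  have W: "smooth_on_open UNIV W"
    unfolding W_def
    by (intro smooth_matrix_mult smooth_diff smooth_const smooth_snd smooth_fst smooth_ident open_UNIV)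
  define T1 where "T1 = UNIV \<inter> W -` U"
  have "open T1"
    unfolding T1_def by (rule open_smooth_preimage[OF W smooth_on_open_open[OF N(1)]])
  have frame: "smooth_on_open T1 frame"
    unfolding frame_def
    by (rule smooth_compose[OF N(1) smooth_subset[OF W \<open>open T1\<close>]]) (auto simp: T1_def)
  have a: "smooth_on_open T1 a" and b: "smooth_on_open T1 b"
    unfolding a_def b_def
    by (intro smooth_Pair smooth_uminus smooth_matrix_mult frame smooth_snd smooth_fst
        smooth_ident \<open>open T1\<close>)+
  define T where "T = (T1 \<inter> a -` UH) \<inter> (T1 \<inter> b -` US)"
  have "open T"
    unfolding T_def
    by (intro open_Int open_smooth_preimage[OF a] open_smooth_preimage[OF b]
        smooth_on_open_open[OF gH(2)] smooth_on_open_open[OF gS(2)])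
  have "T \<subseteq> T1"
    by (auto simp: T_def)
  then have "smooth_on_open T a" "smooth_on_open T b"
    using smooth_subset[OF a \<open>open T\<close>] smooth_subset[OF b \<open>open T\<close>] by simp_all
  then have ga: "smooth_on_open T (\<lambda>p. gH (a p))" and gb: "smooth_on_open T (\<lambda>p. gS (b p))"
    by (auto intro: smooth_compose[OF gH(2)] smooth_compose[OF gS(2)] simp: T_def)
  define g where "g = (\<lambda>p. (gH (a p) ** transpose (gS (b p)),
    mat 1 - gS (b p) ** transpose (gS (b p))))"
  have "smooth_on_open T g"
    unfolding g_def
    by (intro smooth_Pair smooth_diff smooth_const smooth_matrix_mult smooth_transpose ga gb \<open>open T\<close>)
  moreover have "p0 \<in> T"
  proof -
    have "W p0 = V0"
      using V0 by (simp add: W_def p0_eq G0 stiefel_def flip: matrix_mul_assoc)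
    then have "frame p0 = V0" "p0 \<in> T1"
      using N(2,5) V0 by (auto simp: frame_def T1_def)
    then have "a p0 = (H0, K0)" "b p0 = (V0, Vp0)"
      by (simp_all add: a_def b_def p0_eq represents_tangent_solve[OF rep0])
    then show ?thesis
      using gH(1) gS(1) \<open>p0 \<in> T1\<close> by (simp add: T_def)
  qed
  moreover have "lifted_map \<iota> h RH RSt p = g p"
    if p: "p \<in> tangent_bundle (Mh CARD('r) h)" "p \<in> T" for p
  proof -
    obtain X G \<eta> \<zeta> where p_eq: "p = ((X, G), (\<eta>, \<zeta>))"
      by (metis surj_pair)
    have G: "G \<in> grassmannian (CARD('n) - CARD('r))"
      using p(1) by (auto simp: p_eq tangent_bundle_def Mh_def)
    have "W p \<in> U"
      using p(2) by (simp add: T_def T1_def)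
    then have F: "frame p \<in> stiefel" and "\<exists>C. frame p = W p ** C"
      using N(3,4) by (auto simp: frame_def)
    then obtain C where C: "frame p = (mat 1 - G) ** V0 ** C"
      by (auto simp: W_def p_eq)
    have "G ** frame p = G ** (mat 1 - G) ** V0 ** C"
      by (simp add: C matrix_mul_assoc)
    also have "G ** (mat 1 - G) = 0"
      using G by (simp add: matrix_mult_algebra grassmannian_def)
    finally have "G ** frame p = 0"
      by (simp add: matrix_mult_algebra)
    then have GF: "mat 1 - G = frame p ** transpose (frame p)"
      by (rule frame_projection_eqI[OF F G])
    note rep = frame_represents[OF \<iota> inv p(1)[unfolded p_eq] F GF]
    have "RH (a p) = gH (a p)" "RSt (b p) = gS (b p)"
      using represents_in_tangent_bundles[OF rep] p(2)
      by (auto intro!: gH(3) gS(3) simp: T_def a_def b_def p_eq)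
    then show ?thesis
      using lifted_map_eqI[OF RSt(2) RH(2) rep] by (simp add: g_def a_def b_def p_eq)
  qed
  ultimately show "\<exists>U g. p0 \<in> U \<and> smooth_on_open U g \<and>
      (\<forall>y\<in>tangent_bundle (Mh CARD('r) h) \<inter> U. lifted_map \<iota> h RH RSt y = g y)"
    by blast
qed

theorem proposition10:
  fixes h :: "real^'n^'m \<Rightarrow> real^'q"
    and \<iota> :: "'r::finite \<Rightarrow> 'n::finite"
    and RSt :: "(real^'r^'n) \<times> (real^'r^'n) \<Rightarrow> real^'r^'n"
    and RH :: "(real^'r^'m) \<times> (real^'r^'m) \<Rightarrow> real^'r^'m"
  assumes "CARD('r) \<le> min CARD('m) CARD('n)"
    and "inj \<iota>"
    and "smooth_on_open UNIV h"
    and "orthogonally_invariant h"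
    and "\<And>X. h X = 0 \<Longrightarrow> dim (range (frechet_derivative h (at X))) = CARD('q)"
    and "is_retraction stiefel RSt"
    and "is_retraction (Hr \<iota> h) RH"
    and "orthogonally_homogeneous stiefel RSt"
    and "orthogonally_homogeneous (Hr \<iota> h) RH"
  shows "(\<forall>x \<in> tangent_bundle (Mh CARD('r) h). \<exists>!Y. lifted_value \<iota> h RH RSt x Y) \<and>
         is_retraction (Mh CARD('r) h) (lifted_map \<iota> h RH RSt)"
proof -
  let ?M = "Mh CARD('r) h :: ((real^'n^'m) \<times> (real^'n^'n)) set" and ?R = "lifted_map \<iota> h RH RSt"
  have le: "CARD('r) \<le> CARD('n)"
    using assms(1) by simp
  note RSt = assms(6)[unfolded is_retraction_def] and RH = assms(7)[unfolded is_retraction_def]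
  note hom = assms(8,9)
  note represented = tangent_vector_represented[OF le assms(2,4)]
  have "\<exists>!Y. lifted_value \<iota> h RH RSt p Y" if p: "p \<in> tangent_bundle ?M" for p
  proof -
    obtain X G \<eta> \<zeta> where p_eq: "p = ((X, G), (\<eta>, \<zeta>))"
      by (metis surj_pair)
    obtain H :: "real^'r^'m" and V :: "real^'r^'n" and K Vp
      where "represents_point \<iota> h H V X G" "represents_tangent \<iota> h H V K Vp \<eta> \<zeta>"
      using represented p unfolding p_eq by metis
    then have "\<exists>Y. lifted_value \<iota> h RH RSt p Y"
      unfolding p_eq by (blast intro: lifted_valueI)
    with lifted_value_unique[OF hom] show ?thesis by blast
  qed
  moreover have "?R ` tangent_bundle ?M \<subseteq> ?M"
  proof (rule image_subsetI)
    fix p assume p: "p \<in> tangent_bundle ?M"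
    obtain X G \<eta> \<zeta> where p_eq: "p = ((X, G), (\<eta>, \<zeta>))"
      by (metis surj_pair)
    obtain H :: "real^'r^'m" and V :: "real^'r^'n" and K Vp
      where rep: "represents_point \<iota> h H V X G" "represents_tangent \<iota> h H V K Vp \<eta> \<zeta>"
      using represented[OF p[unfolded p_eq]] .
    have "RH (H, K) \<in> Hr \<iota> h" "RSt (V, Vp) \<in> stiefel"
      using RH RSt represents_in_tangent_bundles[OF rep] by blast+
    then show "?R p \<in> ?M"
      unfolding p_eq lifted_map_eqI[OF hom rep] by (rule frame_product_in_Mh[OF assms(2,4)])
  qed
  moreover have "smooth_map_on (tangent_bundle ?M) ?R"
    using RSt RH by (intro smooth_lifted_map le assms(2,4) hom) auto
  moreover have "?R (x, 0 *\<^sub>R \<xi>) = x \<and> ((\<lambda>t. ?R (x, t *\<^sub>R \<xi>)) has_vector_derivative \<xi>) (at 0)"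
    if "x \<in> ?M" "\<xi> \<in> tangent_space ?M x" for x \<xi>
  proof -
    obtain X G \<eta> \<zeta> where eq: "x = (X, G)" "\<xi> = (\<eta>, \<zeta>)"
      by (metis surj_pair)
    have "((X, G), (\<eta>, \<zeta>)) \<in> tangent_bundle ?M"
      using that by (simp add: tangent_bundle_def eq)
    then obtain H :: "real^'r^'m" and V :: "real^'r^'n" and K Vp
      where rep: "represents_point \<iota> h H V X G" "represents_tangent \<iota> h H V K Vp \<eta> \<zeta>"
      by (rule represented)
    have scaled: "represents_tangent \<iota> h H V (t *\<^sub>R K) (t *\<^sub>R Vp) (t *\<^sub>R \<eta>) (t *\<^sub>R \<zeta>)" for t
      using rep(2) tangent_space_scaleR
      by (auto simp: represents_tangent_def matrix_mult_algebra transpose_algebra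
          scaleR_right_distrib scaleR_right_diff_distrib)
    have R: "?R (x, t *\<^sub>R \<xi>) = (RH (H, t *\<^sub>R K) ** transpose (RSt (V, t *\<^sub>R Vp)),
        mat 1 - RSt (V, t *\<^sub>R Vp) ** transpose (RSt (V, t *\<^sub>R Vp)))" for t
      using lifted_map_eqI[OF hom rep(1) scaled] by (simp add: eq)
    have H: "RH (H, 0 *\<^sub>R K) = H" "((\<lambda>t. RH (H, t *\<^sub>R K)) has_vector_derivative K) (at 0)"
      using RH represents_in_tangent_bundles(1)[OF rep] unfolding tangent_bundle_def by blast+
    have V: "RSt (V, 0 *\<^sub>R Vp) = V" "((\<lambda>t. RSt (V, t *\<^sub>R Vp)) has_vector_derivative Vp) (at 0)"
      using RSt represents_in_tangent_bundles(2)[OF rep] unfolding tangent_bundle_def by blast+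
    note V' = has_vector_derivative_transpose[OF V(2)]
    have "((\<lambda>t. RH (H, t *\<^sub>R K) ** transpose (RSt (V, t *\<^sub>R Vp))) has_vector_derivative \<eta>) (at 0)"
      using has_vector_derivative_matrix_mult[OF H(2) V'] rep(2) H(1) V(1)
      by (simp add: represents_tangent_def add.commute)
    moreover have "((\<lambda>t. mat 1 - RSt (V, t *\<^sub>R Vp) ** transpose (RSt (V, t *\<^sub>R Vp)))
        has_vector_derivative \<zeta>) (at 0)"
      using has_vector_derivative_diff[OF has_vector_derivative_const[of "mat 1"]
          has_vector_derivative_matrix_mult[OF V(2) V']] rep(2) V(1)
      by (simp add: represents_tangent_def add.commute)
    ultimately have "((\<lambda>t. ?R (x, t *\<^sub>R \<xi>)) has_vector_derivative \<xi>) (at 0)"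
      unfolding R unfolding eq(2) by (rule has_vector_derivative_Pair)
    moreover have "?R (x, 0 *\<^sub>R \<xi>) = x"
      unfolding R H(1) V(1) using rep(1) by (simp add: eq represents_point_def)
    ultimately show ?thesis by blast
  qed
  ultimately show ?thesis
    unfolding is_retraction_def by blast
qed

end
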